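(* For every positive integer $d$, there exists a finitely presented associative algebra $R$ (generated by a finite set $X$) whose growth function $\gamma_{X,R}$ satisfies $\gamma_{X,R}\sim e^{n^{d/(d+1)}}$; in particular $R$ has intermediate growth.
   Context: For an algebra $R$ over a field $k$ generated by a finite set $X$, let $X^n$ be the subspace spanned by all monomials in $X$ of length at most $n$, and define the growth function $\gamma_{X,R}(n)=\dim_k X^n$. For monotone functions $f,g:\mathbb{N}\to\mathbb{N}$ write $f\precsim g$ if there is a constant $C\in\mathbb{N}$ with $f(n)\le C\,g(Cn)$ for all $n$, and $f\sim g$ if $f\precsim g$ and $g\precsim f$; the class $[f]$ of $f$ under $\sim$ is its growth type (independent of the finite generating set). A growth type is intermediate if it is strictly smaller than $[2^n]$ (i.e. $\gamma\precsim 2^n$ but not $2^n\precsim\gamma$) and strictly greater than $[n^m]$ for every $m$. *)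

theory Defs
  imports Complex_Main
begin

text \<open>The free associative (unital) algebra over a field 'k on the generators 0..m-1:
  elements are finitely supported functions from words (nat lists over {..<m}) to 'k.\<close>

definition fa_elem :: "nat \<Rightarrow> (nat list \<Rightarrow> 'k::field) \<Rightarrow> bool" where
  "fa_elem m f \<longleftrightarrow> finite {w. f w \<noteq> 0} \<and> (\<forall>w. f w \<noteq> 0 \<longrightarrow> set w \<subseteq> {..<m})"

definition mon :: "nat list \<Rightarrow> nat list \<Rightarrow> 'k::field" where
  "mon w = (\<lambda>u. if u = w then 1 else 0)"

definition fa_mult :: "(nat list \<Rightarrow> 'k::field) \<Rightarrow> (nat list \<Rightarrow> 'k) \<Rightarrow> nat list \<Rightarrow> 'k" where
  "fa_mult f g = (\<lambda>w. \<Sum>i\<le>length w. f (take i w) * g (drop i w))"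

definition kspan :: "(nat list \<Rightarrow> 'k::field) set \<Rightarrow> (nat list \<Rightarrow> 'k) set" where
  "kspan S = {f. \<exists>A c. finite A \<and> A \<subseteq> S \<and> f = (\<lambda>w. \<Sum>a\<in>A. c a * a w)}"

definition fp_ideal :: "nat \<Rightarrow> (nat list \<Rightarrow> 'k::field) list \<Rightarrow> (nat list \<Rightarrow> 'k) set" where
  "fp_ideal m rels = kspan {fa_mult (fa_mult (mon u) r) (mon v) | u v r.
      set u \<subseteq> {..<m} \<and> set v \<subseteq> {..<m} \<and> r \<in> set rels}"

definition Vn :: "nat \<Rightarrow> nat \<Rightarrow> (nat list \<Rightarrow> 'k::field) set" where
  "Vn m n = kspan {mon w | w. set w \<subseteq> {..<m} \<and> length w \<le> n}"

definition indep_mod :: "(nat list \<Rightarrow> 'k::field) set \<Rightarrow> (nat list \<Rightarrow> 'k) set \<Rightarrow> bool" where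
  "indep_mod I A \<longleftrightarrow> (\<forall>c. (\<lambda>w. \<Sum>a\<in>A. c a * a w) \<in> I \<longrightarrow> (\<forall>a\<in>A. c a = 0))"

text \<open>Growth function of R = k<x_0..x_{m-1}> / (rels) w.r.t. the generating set X given by
  the images of the generators: gamma(n) = dim_k X^n, where X^n is the image of Vn m n in R.
  The dimension of the image is the maximal number of elements of Vn m n that are
  linearly independent modulo the ideal.\<close>
definition growth :: "nat \<Rightarrow> (nat list \<Rightarrow> 'k::field) list \<Rightarrow> nat \<Rightarrow> nat" where
  "growth m rels n = Max {card A | A. finite A \<and> A \<subseteq> Vn m n \<and> indep_mod (fp_ideal m rels) A}"

text \<open>Growth preorder and equivalence (real-valued functions, to allow e^(n^a)).\<close>
definition gle :: "(nat \<Rightarrow> real) \<Rightarrow> (nat \<Rightarrow> real) \<Rightarrow> bool" where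
  "gle f g \<longleftrightarrow> (\<exists>C::nat. \<forall>n. f n \<le> real C * g (C * n))"

definition gequiv :: "(nat \<Rightarrow> real) \<Rightarrow> (nat \<Rightarrow> real) \<Rightarrow> bool" where
  "gequiv f g \<longleftrightarrow> gle f g \<and> gle g f"

definition intermediate :: "(nat \<Rightarrow> real) \<Rightarrow> bool" where
  "intermediate f \<longleftrightarrow> gle f (\<lambda>n. 2 ^ n) \<and> \<not> gle (\<lambda>n. 2 ^ n) f \<and>
     (\<forall>k::nat. gle (\<lambda>n. real n ^ k) f \<and> \<not> gle f (\<lambda>n. real n ^ k))"

end

(* The algebra is a kind of wreath product: commuting x_1, ..., x_d act as derivations
   on commuting variables Y_alpha (alpha in N^d) by Y_alpha |-> Y_(alpha + e_i), where
   Y_alpha = ad(x)^alpha (y). Commutativity of all the Y_alpha is an infinite set of relations.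
   To obtain it from finitely many, add commuting generators t_i acting on products of k variables
   as the second elementary symmetric function of the k shifts of which x_i is the first:
   t_i y = y t_i + [x_i, y] x_i. Applying ad x_i to [Y_alpha, Y_beta] = 0 moves e_i between alpha and
   beta up to sign, and applying t_i gives [Y_(alpha + e_i), Y_(beta + e_i)] = 0; so only the
   relations [y, Y_alpha] = 0 with small alpha are needed. This works in every characteristic,
   whereas derivations alone do not suffice in characteristic 2.

   The algebra has the spanning set (product of Y's) x^beta t^gamma, and the products of Y's are
   independent because they act as the corresponding monomials. So the growth is that of the
   number of multisets of vectors in N^d of total weight n, that is exp (n^(d/(d+1))). *)

theory Submission
  imports Defs "HOL-Library.Multiset" "HOL-Library.FuncSet" "HOL-Analysis.Summation_Tests"
    "HOL-Real_Asymp.Real_Asymp"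
begin

section \<open>Noncommutative power series and quotient dimensions\<close>

text \<open>The two bounds use different families: all (product of Y's) x^beta t^gamma from above,
  only the products of Y's from below. They differ by the polynomially many choices of (beta, gamma)
  and by a factor 2 in n: moving t_i to the right past Y_alpha can leave Y_(alpha + e_i) x_i, whose
  weight exceeds that of Y_alpha by 2. Growth equivalence absorbs both. The exponent d/(d+1) comes
  from balancing at a scale L. There are L^d vectors with coordinates below L, each of weight of
  order at most L, so the subsets of this box give 2^(L^d) products of weight of order at most
  L^(d+1). From above, the generating function at exp(-1/L) bounds the count by exp(c n/L + c' L^d).
  Both meet at L = n^(1/(d+1)).\<close>

text \<open>All functions on words, not only the finitely supported ones, form a ring under
  \<^const>\<open>fa_mult\<close>; this avoids carrying finiteness conditions.\<close>

typedef 'k ncs = "UNIV :: (nat list \<Rightarrow> 'k) set"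
  morphisms cf Ncs ..

lemma cf_Ncs [simp]: "cf (Ncs f) = f"
  by (simp add: Ncs_inverse)

lemma ncs_eqI: "(\<And>w. cf a w = cf b w) \<Longrightarrow> a = b"
  by (metis cf_inject ext)

instantiation ncs :: (field) ring_1
begin

definition "0 = Ncs (\<lambda>w. 0)"
definition "1 = Ncs (mon [])"
definition "a + b = Ncs (\<lambda>w. cf a w + cf b w)"
definition "a - b = Ncs (\<lambda>w. cf a w - cf b w)"
definition "- a = Ncs (\<lambda>w. - cf a w)"
definition "a * b = Ncs (fa_mult (cf a) (cf b))"

text \<open>Both sides sum over the two cut points i \<le> j of the word; only the order of
  summation differs.\<close>

lemma fa_mult_assoc:
  "fa_mult (fa_mult f g) h w = fa_mult f (fa_mult g h) (w :: nat list)" for f :: "nat list \<Rightarrow> 'k::field"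
proof -
  let ?n = "length w"
  have "fa_mult (fa_mult f g) h w =
      (\<Sum>j\<le>?n. \<Sum>i\<le>j. f (take i w) * g (take (j - i) (drop i w)) * h (drop j w))"
    by (auto simp: fa_mult_def sum_distrib_right drop_take min_def intro!: sum.cong)
  also have "\<dots> = (\<Sum>i\<le>?n. \<Sum>j\<in>{i..?n}. f (take i w) * g (take (j - i) (drop i w)) * h (drop j w))"
    unfolding sum.Sigma[OF finite_atMost ballI[OF finite_atMost]]
      sum.Sigma[OF finite_atMost ballI[OF finite_atLeastAtMost]]
    by (rule sum.reindex_bij_witness[where i = "\<lambda>(i, j). (j, i)" and j = "\<lambda>(i, j). (j, i)"]) auto
  also have "\<dots> = (\<Sum>i\<le>?n. \<Sum>j\<le>?n - i. f (take i w) * g (take j (drop i w)) * h (drop j (drop i w)))"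
  proof (rule sum.cong[OF refl])
    fix i assume "i \<in> {..?n}"
    then show "(\<Sum>j\<in>{i..?n}. f (take i w) * g (take (j - i) (drop i w)) * h (drop j w)) =
      (\<Sum>j\<le>?n - i. f (take i w) * g (take j (drop i w)) * h (drop j (drop i w)))"
      by (intro sum.reindex_bij_witness[where i = "\<lambda>j. j + i" and j = "\<lambda>j. j - i"])
        (auto simp: add.commute)
  qed
  also have "\<dots> = fa_mult f (fa_mult g h) w"
    by (simp add: fa_mult_def sum_distrib_left mult.assoc)
  finally show ?thesis .
qed

lemma fa_mult_one_left: "fa_mult (mon []) f w = (f w :: 'k::field)"
proof -
  have "fa_mult (mon []) f w = (\<Sum>i\<le>length w. if i = 0 then f w else 0)"
    unfolding fa_mult_def by (intro sum.cong refl) (auto simp: mon_def)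
  then show ?thesis by simp
qed

lemma fa_mult_one_right: "fa_mult f (mon []) w = (f w :: 'k::field)"
proof -
  have "fa_mult f (mon []) w = (\<Sum>i\<le>length w. if i = length w then f w else 0)"
    unfolding fa_mult_def by (intro sum.cong refl) (auto simp: mon_def)
  then show ?thesis by simp
qed

instance
proof
  fix a b c :: "'a ncs"
  show "a * b * c = a * (b * c)"
    by (intro ncs_eqI) (simp add: times_ncs_def fa_mult_assoc)
  show "1 * a = a" "a * 1 = a"
    by (simp_all add: times_ncs_def one_ncs_def fa_mult_one_left fa_mult_one_right ncs_eqI)
  show "(a + b) * c = a * c + b * c" "a * (b + c) = a * b + a * c"
    by (simp_all add: times_ncs_def plus_ncs_def fa_mult_def algebra_simps sum.distrib)
  have "cf (0 :: 'a ncs) [] \<noteq> cf 1 []"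
    by (simp add: zero_ncs_def one_ncs_def mon_def)
  then show "(0 :: 'a ncs) \<noteq> 1" by metis
qed (auto simp: plus_ncs_def zero_ncs_def uminus_ncs_def minus_ncs_def algebra_simps intro!: ncs_eqI)

end

definition scl :: "'k::field \<Rightarrow> 'k ncs \<Rightarrow> 'k ncs" where
  "scl c a = Ncs (\<lambda>w. c * cf a w)"

definition word :: "nat list \<Rightarrow> 'k::field ncs" where
  "word w = Ncs (mon w)"

lemma cf_simps [simp]:
  "cf 0 w = 0" "cf (a + b) w = cf a w + cf b w" "cf (a - b) w = cf a w - cf b w"
  "cf (- a) w = - cf a w" "cf (scl c a) w = c * cf a w"
  by (simp_all add: zero_ncs_def plus_ncs_def minus_ncs_def uminus_ncs_def scl_def)

lemma cf_mult: "cf (a * b) = fa_mult (cf a) (cf b)"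
  by (simp add: times_ncs_def)

lemma cf_sum: "cf (sum f A) w = (\<Sum>a\<in>A. cf (f a) w)"
  by (induction A rule: infinite_finite_induct) auto

lemma cf_word: "cf (word u) w = (if w = u then 1 else 0)"
  by (simp add: word_def mon_def)

interpretation ncs: vector_space scl
  by unfold_locales (auto simp: algebra_simps intro!: ncs_eqI)

lemma scl_mult_left [simp]: "scl c a * b = scl c (a * b)"
  by (intro ncs_eqI) (simp add: cf_mult fa_mult_def sum_distrib_left mult.assoc)

lemma scl_mult_right [simp]: "a * scl c b = scl c (a * b)"
  by (intro ncs_eqI) (simp add: cf_mult fa_mult_def sum_distrib_left mult.left_commute)

lemma word_Nil: "word [] = 1"
  by (simp add: word_def one_ncs_def)

lemma word_append: "word u * word v = word (u @ v)"
proof (intro ncs_eqI)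
  fix w :: "nat list"
  have "cf (word u * word v :: 'a ncs) w =
      (\<Sum>i\<le>length w. if i = length u then (if w = u @ v then 1 else 0) else 0)"
    unfolding cf_mult fa_mult_def cf_word
  proof (intro sum.cong refl)
    fix i assume "i \<in> {..length w}"
    then show "(if take i w = u then 1 else 0) * (if drop i w = v then 1 else 0) =
      (if i = length u then if w = u @ v then 1 else 0 else (0 :: 'a))"
      using append_eq_conv_conj[of "take i w" "drop i w" "u @ v"] append_eq_append_conv[of "take i w" u "drop i w" v]
      by (cases "i = length u") (auto simp: min_def split: if_splits)
  qed
  then show "cf (word u * word v :: 'a ncs) w = cf (word (u @ v)) w"
    by (auto simp: cf_word)
qed

lemma word_Cons: "word (i # w) = word [i] * word w"
  by (simp add: word_append)

text \<open>Identifies the explicitly defined span with the library notion, and so gives access to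
  the exchange lemma used in \<open>card_indep_ncs_le\<close>.\<close>

lemma span_Ncs_kspan: "cf ` ncs.span S = kspan (cf ` S)"
proof -
  have inj: "inj_on cf T" for T :: "'a ncs set"
    by (meson cf_inject inj_onI)
  show ?thesis
  proof (intro equalityI subsetI)
    fix f assume "f \<in> cf ` ncs.span S"
    then obtain T r where T: "finite T" "T \<subseteq> S" "f = cf (\<Sum>a\<in>T. scl (r a) a)"
      unfolding ncs.span_explicit by auto
    have "f = (\<lambda>w. \<Sum>a\<in>cf ` T. (r \<circ> Ncs) a * a w)"
      unfolding T by (auto simp: cf_sum sum.reindex[OF inj] cf_inverse)
    with T show "f \<in> kspan (cf ` S)"
      unfolding kspan_def by (intro CollectI exI[of _ "cf ` T"] exI[of _ "r \<circ> Ncs"]) auto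
  next
    fix f assume "f \<in> kspan (cf ` S)"
    then obtain T r where T: "finite T" "T \<subseteq> cf ` S" "f = (\<lambda>w. \<Sum>a\<in>T. r a * a w)"
      unfolding kspan_def by auto
    obtain T' where T': "T' \<subseteq> S" "T = cf ` T'"
      using T(2) by (auto simp: subset_image_iff)
    have "f = cf (\<Sum>a\<in>T'. scl (r (cf a)) a)"
      unfolding T T'(2) by (auto simp: cf_sum sum.reindex[OF inj])
    moreover have "finite T'" using T(1) T'(2) finite_imageD[OF _ inj] by auto
    ultimately show "f \<in> cf ` ncs.span S"
      unfolding ncs.span_explicit using T' by (intro image_eqI) auto
  qed
qed

section \<open>Filtration, ideal and growth in the language of series\<close>

definition letters_below :: "nat \<Rightarrow> 'k::field ncs set" where
  "letters_below m = ncs.span {word w | w. set w \<subseteq> {..<m}}"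

definition filt :: "nat \<Rightarrow> nat \<Rightarrow> 'k::field ncs set" where
  "filt m n = ncs.span {word w | w. set w \<subseteq> {..<m} \<and> length w \<le> n}"

definition rel_ideal :: "nat \<Rightarrow> 'k::field ncs set \<Rightarrow> 'k ncs set" where
  "rel_ideal m R = ncs.span {word u * r * word v | u v r. set u \<subseteq> {..<m} \<and> set v \<subseteq> {..<m} \<and> r \<in> R}"

definition indep_ncs :: "'k::field ncs set \<Rightarrow> 'k ncs set \<Rightarrow> bool" where
  "indep_ncs I A \<longleftrightarrow> (\<forall>c. (\<Sum>a\<in>A. scl (c a) a) \<in> I \<longrightarrow> (\<forall>a\<in>A. c a = 0))"

lemma Vn_eq_filt: "Vn m n = cf ` filt m n"
  unfolding Vn_def filt_def span_Ncs_kspan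
  by (rule arg_cong[of _ _ kspan]) (force simp: word_def image_iff)

lemma fp_ideal_eq_rel_ideal: "set rels = cf ` R \<Longrightarrow> fp_ideal m rels = cf ` rel_ideal m R"
  unfolding fp_ideal_def rel_ideal_def span_Ncs_kspan
  by (rule arg_cong[of _ _ kspan]) (force simp: word_def cf_mult image_iff)

lemma indep_mod_iff: "indep_mod (cf ` I) (cf ` A) \<longleftrightarrow> indep_ncs I A"
proof -
  have inj: "inj_on cf T" for T :: "'a ncs set"
    by (meson cf_inject inj_onI)
  have eq: "(\<lambda>w. \<Sum>a\<in>cf ` A. c a * a w) = cf (\<Sum>a\<in>A. scl (c (cf a)) a)" for c
    by (auto simp: cf_sum sum.reindex[OF inj])
  have mem: "cf x \<in> cf ` I \<longleftrightarrow> x \<in> I" for x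
    by (auto simp: cf_inject)
  show ?thesis
  proof
    assume *: "indep_mod (cf ` I) (cf ` A)"
    show "indep_ncs I A"
      unfolding indep_ncs_def
    proof (intro allI impI ballI)
      fix c a assume "(\<Sum>a\<in>A. scl (c a) a) \<in> I" "a \<in> A"
      then show "c a = 0"
        using *[unfolded indep_mod_def eq mem, rule_format, of "c \<circ> Ncs" "cf a"]
        by (simp add: cf_inverse)
    qed
  next
    assume *: "indep_ncs I A"
    show "indep_mod (cf ` I) (cf ` A)"
      unfolding indep_mod_def eq mem using *[unfolded indep_ncs_def, rule_format, of "c \<circ> cf" for c]
      by auto
  qed
qed

lemma growth_ncs:
  assumes "set rels = cf ` R"
  shows "growth m rels n = Max {card A | A. finite A \<and> A \<subseteq> filt m n \<and> indep_ncs (rel_ideal m R) A}"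
proof -
  have inj: "inj_on cf T" for T :: "'a ncs set"
    by (meson cf_inject inj_onI)
  have "{card A | A. finite A \<and> A \<subseteq> Vn m n \<and> indep_mod (fp_ideal m rels) A} =
        {card A | A. finite A \<and> A \<subseteq> filt m n \<and> indep_ncs (rel_ideal m R) A}" (is "?l = ?r")
  proof (intro equalityI subsetI)
    fix k assume "k \<in> ?l"
    then obtain A where A: "k = card A" "finite A" "A \<subseteq> cf ` filt m n" "indep_mod (cf ` rel_ideal m R) A"
      unfolding Vn_eq_filt fp_ideal_eq_rel_ideal[OF assms] by blast
    then obtain A' where "A' \<subseteq> filt m n" "A = cf ` A'"
      by (auto simp: subset_image_iff)
    with A show "k \<in> ?r"
      using card_image[OF inj, of A'] finite_imageD[OF _ inj, of A'] by (auto simp: indep_mod_iff)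
  next
    fix k assume "k \<in> ?r"
    then obtain A where "k = card A" "finite A" "A \<subseteq> filt m n" "indep_ncs (rel_ideal m R) A"
      by blast
    then show "k \<in> ?l"
      unfolding Vn_eq_filt fp_ideal_eq_rel_ideal[OF assms]
      using card_image[OF inj, of A] by (intro CollectI exI[of _ "cf ` A"]) (auto simp: indep_mod_iff)
  qed
  then show ?thesis by (simp add: growth_def)
qed

text \<open>Each element of \<open>A\<close> is replaced by a representative in the span of
  \<open>N\<close>, congruent to it modulo \<open>I\<close>. Independence modulo \<open>I\<close>
  makes the representatives distinct and independent, so the exchange lemma applies in the ambient
  space and no quotient is formed.\<close>

lemma card_indep_ncs_le:
  assumes I: "ncs.subspace I" and N: "finite N" and A: "finite A" "indep_ncs I A"
    and sub: "A \<subseteq> ncs.span (N \<union> I)"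
  shows "card A \<le> card N"
proof -
  have "\<exists>b. b \<in> ncs.span N \<and> a - b \<in> I" if "a \<in> A" for a
  proof -
    have "a \<in> ncs.span (N \<union> I)" using sub that by blast
    then obtain b c where "a = b + c" "b \<in> ncs.span N" "c \<in> ncs.span I"
      unfolding ncs.span_Un by blast
    moreover have "ncs.span I = I" using I by simp
    ultimately show ?thesis by (intro exI[of _ b]) auto
  qed
  then obtain r where r: "\<And>a. a \<in> A \<Longrightarrow> r a \<in> ncs.span N" "\<And>a. a \<in> A \<Longrightarrow> a - r a \<in> I"
    by metis
  have indep: "\<forall>a\<in>A. c a = 0" if "(\<Sum>a\<in>A. scl (c a) (r a)) \<in> I" for c
  proof -
    have "(\<Sum>a\<in>A. scl (c a) a) = (\<Sum>a\<in>A. scl (c a) (r a)) + (\<Sum>a\<in>A. scl (c a) (a - r a))"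
      by (simp add: ncs.scale_right_diff_distrib sum_subtractf)
    also have "\<dots> \<in> I"
      by (rule ncs.subspace_add[OF I that ncs.subspace_sum[OF I ncs.subspace_scale[OF I r(2)]]])
    finally show ?thesis using A(2) by (auto simp: indep_ncs_def)
  qed
  have zero: "0 \<in> I" using I by (rule ncs.subspace_0)
  have inj: "inj_on r A"
  proof (rule inj_onI, rule ccontr)
    fix a b assume ab: "a \<in> A" "b \<in> A" "r a = r b" "a \<noteq> b"
    \<comment> \<open>Two equal representatives would give a vanishing combination with coefficients
      1 and -1.\<close>
    let ?c = "\<lambda>x. if x = a then 1 else if x = b then -1 else 0 :: 'a"
    have "(\<Sum>x\<in>A. scl (?c x) (r x)) = (\<Sum>x\<in>{a, b}. scl (?c x) (r x))"
      using A ab by (intro sum.mono_neutral_right) auto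
    also have "\<dots> = 0" using ab by simp
    finally show False using indep[of ?c] ab zero by auto
  qed
  have "ncs.independent (r ` A)"
    unfolding ncs.dependent_finite[OF finite_imageI[OF A(1)]]
    using indep[of "u \<circ> r" for u] by (auto simp: sum.reindex[OF inj] zero)
  moreover have "r ` A \<subseteq> ncs.span N" using r by auto
  ultimately have "card (r ` A) \<le> card N"
    using ncs.independent_span_bound[OF N] by blast
  then show ?thesis by (simp add: card_image[OF inj])
qed

section \<open>The spanning set\<close>

text \<open>Adjacent swaps generate all permutations: the head of \<open>xs\<close> is located in
  \<open>ys\<close> and carried to the front. As an induction rule this extends a congruence for two
  neighbours to any reordering, both for the letters of one Y and for the factors of a product;
  \<open>S\<close> carries the side conditions on the entries.\<close>

lemma mset_eq_swap_induct [consumes 2, case_names refl trans swap Cons]: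
  assumes "mset xs = mset ys" "set xs \<subseteq> S"
    and refl: "\<And>xs. P xs xs"
    and trans: "\<And>xs ys zs. P xs ys \<Longrightarrow> P ys zs \<Longrightarrow> P xs zs"
    and swap: "\<And>a b xs. a \<in> S \<Longrightarrow> b \<in> S \<Longrightarrow> set xs \<subseteq> S \<Longrightarrow> P (a # b # xs) (b # a # xs)"
    and Cons: "\<And>a xs ys. a \<in> S \<Longrightarrow> set xs \<subseteq> S \<Longrightarrow> set ys \<subseteq> S \<Longrightarrow> P xs ys \<Longrightarrow> P (a # xs) (a # ys)"
  shows "P xs ys"
  using assms(1,2)
proof (induction xs arbitrary: ys)
  case Nil
  then show ?case using refl by auto
next
  case (Cons a xs)
  have "a \<in> set ys" using Cons.prems(1) by (metis list.set_intros(1) mset_eq_setD)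
  then obtain p q where ys: "ys = p @ a # q" by (meson split_list)
  have set: "set ys = set (a # xs)" using Cons.prems(1) by (metis mset_eq_setD)
  have front: "P (a # p @ q) (p @ a # q)" if "set (p @ q) \<subseteq> S" for p
    using that
  proof (induction p)
    case Nil
    then show ?case using refl by auto
  next
    case (Cons b p)
    have "P (a # b # p @ q) (b # a # p @ q)"
      using Cons.prems \<open>set (a # xs) \<subseteq> S\<close> by (intro swap) auto
    moreover have "P (b # a # p @ q) (b # p @ a # q)"
      using Cons \<open>set (a # xs) \<subseteq> S\<close> by (intro assms(6)) auto
    ultimately show ?case using trans by auto
  qed
  have "mset xs = mset (p @ q)" using Cons.prems(1) ys by auto
  then have "P xs (p @ q)" using Cons.IH Cons.prems(2) by auto
  then have "P (a # xs) (a # p @ q)"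
    using set Cons.prems(2) ys by (intro assms(6)) auto
  moreover have "set (p @ q) \<subseteq> S" using set Cons.prems(2) ys by auto
  ultimately show ?case using trans front ys by blast
qed

text \<open>The iterated commutator of the x_i with y, where y is the letter \<open>2 * d\<close>.
  The index is a word rather than an exponent vector because reordering it is harmless only modulo
  the relations.\<close>

fun ad_word :: "nat \<Rightarrow> nat list \<Rightarrow> 'k::field ncs" where
  "ad_word d [] = word [2 * d]"
| "ad_word d (i # w) = word [i] * ad_word d w - ad_word d w * word [i]"

lemma word_in_letters_below: "set w \<subseteq> {..<m} \<Longrightarrow> word w \<in> letters_below m"
  unfolding letters_below_def by (intro ncs.span_base) auto

text \<open>Arbitrary predicates on words let one induction serve the subalgebra on \<open>m\<close>
  letters, the length filtration and the space of all polynomials.\<close>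

lemma span_word_mult:
  fixes a b :: "'k::field ncs"
  assumes "a \<in> ncs.span {word w | w. P w}" "b \<in> ncs.span {word w | w. Q w}"
    and PQR: "\<And>u v. P u \<Longrightarrow> Q v \<Longrightarrow> R (u @ v)"
  shows "a * b \<in> ncs.span {word w | w. R w}"
  using assms(1)
proof (induction rule: ncs.span_induct_alt)
  case base
  then show ?case by (simp add: ncs.span_zero)
next
  case (step c u a)
  then obtain w where w: "u = word w" "P w" by auto
  have "word w * b \<in> ncs.span {word w | w. R w}"
    using assms(2)
  proof (induction rule: ncs.span_induct_alt)
    case base
    then show ?case by (simp add: ncs.span_zero)
  next
    case (step c' u' a')
    then obtain w' where w': "u' = word w'" "Q w'" by auto
    have "(word (w @ w') :: 'k ncs) \<in> ncs.span {word w | w. R w}"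
      using w w' PQR by (intro ncs.span_base CollectI exI[of _ "w @ w'"]) auto
    with step(2) w' show ?case
      by (simp only: distrib_left word_append ncs.span_add ncs.span_scale scl_mult_right)
  qed
  with step(2) w show ?case
    by (simp only: distrib_right ncs.span_add ncs.span_scale scl_mult_left)
qed

lemma letters_below_mult:
  "a \<in> letters_below m \<Longrightarrow> b \<in> letters_below m \<Longrightarrow> a * b \<in> letters_below m"
  unfolding letters_below_def by (erule (1) span_word_mult) auto

lemma filt_mult:
  "a \<in> filt m k \<Longrightarrow> b \<in> filt m l \<Longrightarrow> a * b \<in> filt m (k + l)"
  unfolding filt_def by (erule (1) span_word_mult) auto

definition rep :: "'b multiset \<Rightarrow> 'b list" where "rep A = (SOME xs. mset xs = A)"

lemma mset_rep [simp]: "mset (rep A) = A"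
  unfolding rep_def by (rule someI_ex) (rule ex_mset)

lemma set_rep [simp]: "set (rep A) = set_mset A"
  by (metis mset_rep set_mset_mset)

text \<open>An exponent vector \<alpha> is encoded as a multiset of indices below \<open>d\<close>,
  and a commutative monomial in the Y's as a multiset of such \<alpha>. The product lives in the
  free algebra, where order matters, so \<open>rep\<close> fixes an arbitrary one.\<close>

definition Y_prod :: "nat \<Rightarrow> nat multiset multiset \<Rightarrow> 'k::field ncs" where
  "Y_prod d A = prod_list (map (\<lambda>\<alpha>. ad_word d (rep \<alpha>)) (rep A))"

lemma ad_word_in_letters_below:
  "set w \<subseteq> {..<d} \<Longrightarrow> (ad_word d w :: 'k::field ncs) \<in> letters_below (Suc (2 * d))"
proof (induction w)
  case Nil
  then show ?case by (simp add: word_in_letters_below)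
next
  case (Cons i w)
  then have "(word [i] :: 'k ncs) \<in> letters_below (Suc (2 * d))" "(ad_word d w :: 'k ncs) \<in> letters_below (Suc (2 * d))"
    by (auto intro!: word_in_letters_below)
  then have "(word [i] * ad_word d w :: 'k ncs) \<in> letters_below (Suc (2 * d))"
    "(ad_word d w * word [i] :: 'k ncs) \<in> letters_below (Suc (2 * d))"
    by (auto intro: letters_below_mult)
  then show ?case
    by (simp add: letters_below_def ncs.span_diff)
qed

section \<open>Commutativity of all the Y's from finitely many relations\<close>

lemma commutator_leibniz:
  "x * (a * b - b * a) - (a * b - b * a) * x =
   ((x * a - a * x) * b - b * (x * a - a * x)) + (a * (x * b - b * x) - (x * b - b * x) * (a :: 'a :: ring))"
  by (simp add: algebra_simps)

text \<open>\<open>ea\<close> and \<open>eb\<close> are the defects of the rule t a = a t + [x, a]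
  x. Where it holds for a and b, moving t through a product gives t a b = a b t + [x, a b] x +
  [x, a] [x, b]; antisymmetrising in a and b isolates the commutator of \<open>a1\<close> and
  \<open>b1\<close>. It occurs with coefficient 1, whereas applying ad x twice to a b would produce
  [x, a] [x, b] with coefficient 2.\<close>

lemma second_coproduct_commutator:
  fixes a b x t :: "'a :: ring"
  defines "a1 \<equiv> x * a - a * x" and "b1 \<equiv> x * b - b * x"
  defines "ea \<equiv> t * a - (a * t + a1 * x)" and "eb \<equiv> t * b - (b * t + b1 * x)"
  shows "a1 * b1 - b1 * a1 = t * (a * b - b * a) - (a * b - b * a) * t
    - (x * (a * b - b * a) - (a * b - b * a) * x) * x - (a * eb + ea * b - b * ea - eb * a)"
  by (simp add: algebra_simps assms)

text \<open>Ideal elements have finite support, so the ideal need not be closed under multiplication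
  by arbitrary series. Closure is therefore required only for factors in
  \<open>letters_below\<close>, which explains the membership side conditions below.\<close>

locale growth_relations =
  fixes d :: nat and I :: "'k::field ncs set"
  assumes subspace: "ncs.subspace I"
    and ideal_left: "p \<in> letters_below (Suc (2 * d)) \<Longrightarrow> a \<in> I \<Longrightarrow> p * a \<in> I"
    and ideal_right: "p \<in> letters_below (Suc (2 * d)) \<Longrightarrow> a \<in> I \<Longrightarrow> a * p \<in> I"
    and rel_comm: "i < 2 * d \<Longrightarrow> j < 2 * d \<Longrightarrow> word [i] * word [j] - word [j] * word [i] \<in> I"
    and rel_second: "i < d \<Longrightarrow> word [d + i] * ad_word d [] -
        (ad_word d [] * word [d + i] + ad_word d [i] * word [i]) \<in> I"
    and rel_short: "set w \<subseteq> {..<d} \<Longrightarrow> length w \<le> d \<Longrightarrow>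
        ad_word d [] * ad_word d w - ad_word d w * ad_word d [] \<in> I"
begin

abbreviation Y :: "nat list \<Rightarrow> 'k ncs" where "Y \<equiv> ad_word d"

definition cong (infix "\<approx>\<^sub>I" 50) where "a \<approx>\<^sub>I b \<longleftrightarrow> a - b \<in> I"

lemmas I_add = ncs.subspace_add[OF subspace] and I_diff = ncs.subspace_diff[OF subspace]
  and I_0 = ncs.subspace_0[OF subspace]

lemma cong_refl [simp]: "a \<approx>\<^sub>I a"
  by (simp add: cong_def I_0)

lemma cong_trans [trans]: "a \<approx>\<^sub>I b \<Longrightarrow> b \<approx>\<^sub>I c \<Longrightarrow> a \<approx>\<^sub>I c"
  using I_add[of "a - b" "b - c"] by (simp add: cong_def)

lemma cong_diff: "a \<approx>\<^sub>I b \<Longrightarrow> a' \<approx>\<^sub>I b' \<Longrightarrow> a - a' \<approx>\<^sub>I b - b'"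
  using I_diff[of "a - b" "a' - b'"] by (simp add: cong_def algebra_simps)

lemma cong_mult_left: "p \<in> letters_below (Suc (2 * d)) \<Longrightarrow> a \<approx>\<^sub>I b \<Longrightarrow> p * a \<approx>\<^sub>I p * b"
  using ideal_left[of p "a - b"] by (simp add: cong_def algebra_simps)

lemma cong_mult_right: "p \<in> letters_below (Suc (2 * d)) \<Longrightarrow> a \<approx>\<^sub>I b \<Longrightarrow> a * p \<approx>\<^sub>I b * p"
  using ideal_right[of p "a - b"] by (simp add: cong_def algebra_simps)

lemma ideal_comm: "p \<in> letters_below (Suc (2 * d)) \<Longrightarrow> a \<in> I \<Longrightarrow> p * a - a * p \<in> I"
  by (intro I_diff ideal_left ideal_right)

lemma ideal_comm': "p \<in> letters_below (Suc (2 * d)) \<Longrightarrow> a \<in> I \<Longrightarrow> a * p - p * a \<in> I"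
  by (intro I_diff ideal_left ideal_right)

lemma cong_in_I: "a \<approx>\<^sub>I b \<Longrightarrow> a \<in> I \<longleftrightarrow> b \<in> I"
  using I_add[of "a - b" b] I_diff[of a "a - b"] by (auto simp: cong_def)

lemma letter [simp]: "i < Suc (2 * d) \<Longrightarrow> word [i] \<in> letters_below (Suc (2 * d))"
  by (simp add: word_in_letters_below)

lemma Y_letters [simp]: "set w \<subseteq> {..<d} \<Longrightarrow> Y w \<in> letters_below (Suc (2 * d))"
  by (rule ad_word_in_letters_below)

text \<open>By the Jacobi identity the difference is the commutator of [x_i, x_j] with
  \<open>Y w\<close>, and [x_i, x_j] lies in \<open>I\<close>.\<close>

lemma Y_swap:
  assumes "i < d" "j < d" "set w \<subseteq> {..<d}"
  shows "Y (i # j # w) \<approx>\<^sub>I Y (j # i # w)"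
proof -
  let ?c = "word [i] * word [j] - word [j] * word [i] :: 'k ncs"
  have c: "?c \<in> I" using assms by (intro rel_comm) auto
  then have "?c * Y w - Y w * ?c \<in> I"
    using assms by (intro ideal_comm'[OF _ c] Y_letters) auto
  moreover have "Y (i # j # w) - Y (j # i # w) = ?c * Y w - Y w * ?c"
    by (simp add: algebra_simps)
  ultimately show ?thesis by (simp add: cong_def)
qed

lemma Y_perm:
  assumes "mset w = mset w'" "set w \<subseteq> {..<d}"
  shows "Y w \<approx>\<^sub>I Y w'"
  using assms
proof (induction rule: mset_eq_swap_induct)
  case (Cons a xs ys)
  then show ?case by (auto intro!: cong_diff cong_mult_left cong_mult_right)
qed (auto intro: cong_trans Y_swap simp del: ad_word.simps)

text \<open>Bracketing the relation for \<open>w\<close> with x_j gives the one for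
  \<open>j # w\<close>, because x_j commutes with t_i and x_i modulo \<open>I\<close>;
  \<open>Y_swap\<close> then brings the new letter into second position.\<close>

lemma second_Y:
  assumes "i < d" "set w \<subseteq> {..<d}"
  shows "word [d + i] * Y w \<approx>\<^sub>I Y w * word [d + i] + Y (i # w) * word [i]"
  using assms(2)
proof (induction w)
  case Nil
  then show ?case using rel_second[OF assms(1)] by (simp add: cong_def)
next
  case (Cons j w)
  have j: "j < d" "set w \<subseteq> {..<d}" using Cons.prems by auto
  let ?t = "word [d + i] :: 'k ncs" and ?x = "word [i] :: 'k ncs" and ?z = "word [j] :: 'k ncs"
  let ?e = "?t * Y w - (Y w * ?t + Y (i # w) * ?x)"
  have e: "?e \<in> I" using Cons.IH j by (simp add: cong_def)
  have tz: "?t * ?z - ?z * ?t \<in> I" and zx: "?z * ?x - ?x * ?z \<in> I"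
    using assms j by (auto intro!: rel_comm)
  have sw: "Y (j # i # w) - Y (i # j # w) \<in> I"
    using Y_swap[OF j(1) assms(1) j(2)] by (simp only: cong_def)
  \<comment> \<open>Stated for arbitrary ring elements so that the commutators stay folded. It is
    used with a = \<open>Y w\<close>, b = \<open>Y (i # w)\<close> and c =
    \<open>Y (i # j # w)\<close>; each group on the right then lies in \<open>I\<close>.\<close>
  have eq: "t * (z * a - a * z) - ((z * a - a * z) * t + c * x) =
     (z * (t * a - (a * t + b * x)) - (t * a - (a * t + b * x)) * z)
     + ((t * z - z * t) * a - a * (t * z - z * t)) + ((z * b - b * z) - c) * x + b * (z * x - x * z)"
    for a b c t x z :: "'k ncs"
    by (simp add: algebra_simps)
  have "?t * Y (j # w) - (Y (j # w) * ?t + Y (i # j # w) * ?x) =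
     (?z * ?e - ?e * ?z) + ((?t * ?z - ?z * ?t) * Y w - Y w * (?t * ?z - ?z * ?t))
     + (Y (j # i # w) - Y (i # j # w)) * ?x + Y (i # w) * (?z * ?x - ?x * ?z)"
    using eq[of ?t ?z "Y w" "Y (i # j # w)" ?x "Y (i # w)"] by (simp only: ad_word.simps)
  also have "\<dots> \<in> I"
    using assms(1) j
    by (intro I_add ideal_comm[OF _ e] ideal_comm'[OF _ tz] ideal_right[OF _ sw] ideal_left[OF _ zx])
      (auto intro!: Y_letters simp del: ad_word.simps)
  finally show ?case by (simp only: cong_def)
qed

definition C where "C u v = Y u * Y v - Y v * Y u"

lemma C_cong_right:
  "set u \<subseteq> {..<d} \<Longrightarrow> Y v \<approx>\<^sub>I Y w \<Longrightarrow> C u v \<approx>\<^sub>I C u w"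
  unfolding C_def by (intro cong_diff cong_mult_left cong_mult_right) auto

lemma C_move:
  assumes "i < d" "set u \<subseteq> {..<d}" "set v \<subseteq> {..<d}" "C u v \<in> I"
  shows "C (i # u) v \<in> I \<longleftrightarrow> C u (i # v) \<in> I"
proof -
  let ?x = "word [i] :: 'k ncs"
  have "?x * C u v - C u v * ?x \<in> I"
    using assms by (intro ideal_comm) auto
  then have sum: "C (i # u) v + C u (i # v) \<in> I"
    using commutator_leibniz[of ?x "Y u" "Y v"] by (simp only: C_def ad_word.simps)
  show ?thesis
    using I_diff[OF sum, of "C (i # u) v"] I_diff[OF sum, of "C u (i # v)"] by auto
qed

lemma C_double:
  assumes "i < d" "set u \<subseteq> {..<d}" "set v \<subseteq> {..<d}" "C u v \<in> I"
  shows "C (i # u) (i # v) \<in> I"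
proof -
  let ?x = "word [i] :: 'k ncs" and ?t = "word [d + i] :: 'k ncs"
  let ?e = "\<lambda>w. ?t * Y w - (Y w * ?t + Y (i # w) * ?x)"
  have e: "?e u \<in> I" "?e v \<in> I"
    using second_Y assms by (auto simp: cong_def)
  have "?t * C u v - C u v * ?t - (?x * C u v - C u v * ?x) * ?x
      - (Y u * ?e v + ?e u * Y v - Y v * ?e u - ?e v * Y u) \<in> I"
    using assms
    by (intro I_diff I_add ideal_comm[OF _ assms(4)] ideal_right[OF _ ideal_comm[OF _ assms(4)]]
        ideal_left[OF _ e(1)] ideal_left[OF _ e(2)] ideal_right[OF _ e(1)] ideal_right[OF _ e(2)]) auto
  also have "?t * C u v - C u v * ?t - (?x * C u v - C u v * ?x) * ?x
      - (Y u * ?e v + ?e u * Y v - Y v * ?e u - ?e v * Y u) = C (i # u) (i # v)"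
    using second_coproduct_commutator[of ?x "Y u" "Y v" ?t] by (simp only: C_def ad_word.simps)
  finally show ?thesis .
qed

text \<open>A word of length greater than \<open>d\<close> repeats a letter \<open>i\<close>; moving one copy to the other side of
  the commutator makes \<open>C_double\<close> applicable.\<close>

lemma C_in_I:
  assumes "set u \<subseteq> {..<d}" "set v \<subseteq> {..<d}"
  shows "C u v \<in> I"
  using assms
proof (induction "length u + length v" arbitrary: u v rule: less_induct)
  case less
  have Nil: "C [] w \<in> I" if w: "set w \<subseteq> {..<d}" "length w = length u + length v" for w
  proof (cases "length w \<le> d")
    case True
    then show ?thesis using rel_short w by (simp add: C_def)
  next
    case False
    have "\<not> distinct w"
      using False w(1) card_mono[of "{..<d}" "set w"] distinct_card[of w] by auto
    then obtain p q r i where pqr: "w = p @ [i] @ q @ [i] @ r"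
      using not_distinct_decomp by blast
    let ?r = "p @ q @ r"
    have i: "i < d" "set ?r \<subseteq> {..<d}" using w pqr by auto
    have "mset w = mset (i # i # ?r)" using pqr by auto
    then have *: "C [] w \<approx>\<^sub>I C [] (i # i # ?r)"
      using w by (intro C_cong_right Y_perm) auto
    \<comment> \<open>Total lengths are smaller by 2 and by 1: the first commutator feeds
      \<open>C_double\<close>, the second licenses moving one \<open>i\<close> across.\<close>
    have "C [] ?r \<in> I" "C [] (i # ?r) \<in> I"
      using i w(2) pqr by (auto intro!: less.hyps)
    then have "C [i] (i # ?r) \<in> I" "C [] (i # i # ?r) \<in> I \<longleftrightarrow> C [i] (i # ?r) \<in> I"
      using C_double[of i "[]" ?r] C_move[of i "[]" "i # ?r"] i by auto
    then show ?thesis using cong_in_I[OF *] by blast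
  qed
  \<comment> \<open>The letters on the left are moved to the right one at a time until the left word
    is empty; each move relies on a commutator of smaller total length.\<close>
  have "C u' v' \<in> I" if "set u' \<subseteq> {..<d}" "set v' \<subseteq> {..<d}"
      "length u' + length v' = length u + length v" for u' v'
    using that
  proof (induction u' arbitrary: v')
    case Nil
    then show ?case using Nil.prems \<open>\<And>w. set w \<subseteq> {..<d} \<Longrightarrow> _ \<Longrightarrow> C [] w \<in> I\<close> by auto
  next
    case (Cons i u')
    have "C u' v' \<in> I" using Cons.prems by (intro less.hyps) auto
    moreover have "C u' (i # v') \<in> I" using Cons.prems by (intro Cons.IH) auto
    ultimately show ?case using C_move[of i u' v'] Cons.prems by auto
  qed
  then show ?case using less.prems by auto
qed

section \<open>Normal forms and their weight under left multiplication\<close>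

definition NF where "NF ws v = prod_list (map Y ws) * word v"

definition valid where "valid ws v \<longleftrightarrow> (\<forall>w\<in>set ws. set w \<subseteq> {..<d}) \<and> set v \<subseteq> {..<2 * d}"

text \<open>The length of the words that appear when all commutators are expanded:
  \<open>Y w\<close> is homogeneous of degree \<open>Suc (length w)\<close>.\<close>

definition wt :: "nat list list \<Rightarrow> nat list \<Rightarrow> nat" where
  "wt ws v = sum_list (map (Suc \<circ> length) ws) + length v"

definition SP where "SP N = ncs.span ({NF ws v | ws v. valid ws v \<and> wt ws v \<le> N} \<union> I)"

lemma SP_add: "a \<in> SP N \<Longrightarrow> b \<in> SP N \<Longrightarrow> a + b \<in> SP N"
  unfolding SP_def by (rule ncs.span_add)

lemma SP_mono: "a \<in> SP N \<Longrightarrow> N \<le> M \<Longrightarrow> a \<in> SP M"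
  unfolding SP_def by (erule subsetD[OF ncs.span_mono, rotated]) (blast intro: le_trans)

lemma NF_in_SP: "valid ws v \<Longrightarrow> wt ws v \<le> N \<Longrightarrow> NF ws v \<in> SP N"
  unfolding SP_def by (intro ncs.span_base) auto

lemma I_in_SP: "a \<in> I \<Longrightarrow> a \<in> SP N"
  unfolding SP_def by (intro ncs.span_base) auto

lemma SP_cong: "a \<approx>\<^sub>I b \<Longrightarrow> b \<in> SP N \<Longrightarrow> a \<in> SP N"
  using SP_add[of "a - b" N b] I_in_SP[of "a - b" N] by (simp add: cong_def)

lemma SP_mult_left:
  assumes p: "p \<in> letters_below (Suc (2 * d))"
    and NF: "\<And>ws v. valid ws v \<Longrightarrow> wt ws v \<le> N \<Longrightarrow> p * NF ws v \<in> SP M"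
    and a: "a \<in> SP N"
  shows "p * a \<in> SP M"
  using a unfolding SP_def
proof (induction rule: ncs.span_induct_alt)
  case base
  then show ?case by (simp add: ncs.span_zero)
next
  case (step c x b)
  have "p * x \<in> SP M" using step(1) NF ideal_left[OF p] I_in_SP by auto
  then show ?case using step(2) unfolding SP_def
    by (simp add: distrib_left ncs.span_add ncs.span_scale)
qed

lemma Y_mult_SP:
  assumes w: "set w \<subseteq> {..<d}" and a: "a \<in> SP N"
  shows "Y w * a \<in> SP (N + Suc (length w))"
proof (rule SP_mult_left[OF _ _ a])
  fix ws v assume *: "valid ws v" "wt ws v \<le> N"
  have "Y w * NF ws v = NF (w # ws) v" by (simp add: NF_def mult.assoc)
  also have "\<dots> \<in> SP (N + Suc (length w))"
    using * w by (intro NF_in_SP) (auto simp: valid_def wt_def)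
  finally show "Y w * NF ws v \<in> SP (N + Suc (length w))" .
qed (use w in auto)

text \<open>x_i \<open>Y w\<close> = \<open>Y (i # w)\<close> + \<open>Y w\<close> x_i holds already
  in the free algebra: x_i either lengthens one factor or ends up among the trailing
  letters.\<close>

lemma x_mult_NF:
  assumes "i < d" "valid ws v"
  shows "word [i] * NF ws v \<in> SP (wt ws v + 1)"
  using assms(2)
proof (induction ws)
  case Nil
  have "word [i] * NF [] v = NF [] (i # v)" by (simp add: NF_def word_append)
  also have "\<dots> \<in> SP (wt [] v + 1)"
    using Nil assms(1) by (intro NF_in_SP) (auto simp: valid_def wt_def)
  finally show ?case .
next
  case (Cons w ws)
  have v: "set w \<subseteq> {..<d}" "valid ws v" using Cons.prems by (auto simp: valid_def)
  have "word [i] * NF (w # ws) v = NF ((i # w) # ws) v + Y w * (word [i] * NF ws v)"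
    by (simp add: NF_def algebra_simps)
  also have "\<dots> \<in> SP (wt (w # ws) v + 1)"
  proof (rule SP_add)
    show "NF ((i # w) # ws) v \<in> SP (wt (w # ws) v + 1)"
      using Cons.prems assms(1) by (auto intro!: NF_in_SP simp: valid_def wt_def)
    have "Y w * (word [i] * NF ws v) \<in> SP (wt ws v + 1 + Suc (length w))"
      using v Cons.IH by (intro Y_mult_SP) auto
    then show "Y w * (word [i] * NF ws v) \<in> SP (wt (w # ws) v + 1)"
      by (rule SP_mono) (simp add: wt_def)
  qed
  finally show ?case .
qed

text \<open>Passing \<open>Y w\<close> leaves either t_i, or the longer factor
  \<open>Y (i # w)\<close> together with an x_i. In the second case the factor gains 1 and the
  remaining x_i adds another 1, hence \<open>+ 2\<close>.\<close>

lemma t_mult_NF: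
  assumes "i < d" "valid ws v"
  shows "word [d + i] * NF ws v \<in> SP (wt ws v + 2)"
  using assms(2)
proof (induction ws)
  case Nil
  have "word [d + i] * NF [] v = NF [] ((d + i) # v)" by (simp add: NF_def word_append)
  also have "\<dots> \<in> SP (wt [] v + 2)"
    using Nil assms(1) by (intro NF_in_SP) (auto simp: valid_def wt_def)
  finally show ?case .
next
  case (Cons w ws)
  have v: "set w \<subseteq> {..<d}" "valid ws v" using Cons.prems by (auto simp: valid_def)
  have NFL: "NF ws v \<in> letters_below (Suc (2 * d))"
  proof -
    have "prod_list (map Y ws) \<in> letters_below (Suc (2 * d))"
      using v(2) word_in_letters_below[of "[]" "Suc (2 * d)"]
      by (induction ws) (auto simp: valid_def word_Nil intro!: letters_below_mult)
    moreover have "word v \<in> letters_below (Suc (2 * d))"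
      using v(2) by (intro word_in_letters_below) (force simp: valid_def)
    ultimately show ?thesis unfolding NF_def by (rule letters_below_mult)
  qed
  have "word [d + i] * NF (w # ws) v = (word [d + i] * Y w) * NF ws v"
    by (simp add: NF_def mult.assoc)
  also have "\<dots> \<approx>\<^sub>I (Y w * word [d + i] + Y (i # w) * word [i]) * NF ws v"
    using assms(1) v NFL by (intro cong_mult_right second_Y) auto
  also have "\<dots> = Y w * (word [d + i] * NF ws v) + Y (i # w) * (word [i] * NF ws v)"
    by (simp only: distrib_right mult.assoc)
  finally have *: "word [d + i] * NF (w # ws) v \<approx>\<^sub>I \<dots>" .
  have "Y w * (word [d + i] * NF ws v) \<in> SP (wt ws v + 2 + Suc (length w))"
    using v Cons.IH by (intro Y_mult_SP) auto
  moreover have "Y (i # w) * (word [i] * NF ws v) \<in> SP (wt ws v + 1 + Suc (length (i # w)))"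
    using v assms(1) by (intro Y_mult_SP x_mult_NF) auto
  ultimately have "Y w * (word [d + i] * NF ws v) + Y (i # w) * (word [i] * NF ws v)
      \<in> SP (wt (w # ws) v + 2)"
    by (intro SP_add) (auto elim!: SP_mono simp: wt_def)
  with * show ?case by (rule SP_cong)
qed

text \<open>Letters are multiplied on from the left, each adding at most 2 to the weight, with t_i
  as the worst case. This is the origin of \<open>2 * n\<close> in the upper bound.\<close>

lemma word_in_SP: "set u \<subseteq> {..<Suc (2 * d)} \<Longrightarrow> word u \<in> SP (2 * length u)"
proof (induction u)
  case Nil
  have "NF [] [] \<in> SP 0" by (intro NF_in_SP) (auto simp: valid_def wt_def)
  then show ?case by (simp add: NF_def)
next
  case (Cons c u)
  have c: "c < Suc (2 * d)" using Cons.prems by auto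
  have "word [c] * word u \<in> SP (2 * length u + 2)"
  proof (rule SP_mult_left)
    show "word [c] \<in> letters_below (Suc (2 * d))" using c by simp
    show "word u \<in> SP (2 * length u)" using Cons by auto
    fix ws v assume *: "valid ws v" "wt ws v \<le> 2 * length u"
    consider "c < d" | i where "c = d + i" "i < d" | "c = 2 * d"
    proof -
      have "c < d \<or> c = 2 * d \<or> c = d + (c - d) \<and> c - d < d" using c by linarith
      then show ?thesis using that by blast
    qed
    then show "word [c] * NF ws v \<in> SP (2 * length u + 2)"
    proof cases
      case 1
      from x_mult_NF[OF this *(1)] show ?thesis by (rule SP_mono) (use * in auto)
    next
      case 2
      from t_mult_NF[OF this(2) *(1)] show ?thesis
        unfolding 2(1) by (rule SP_mono) (use * in auto)
    next
      case 3
      have "Y [] * NF ws v \<in> SP (2 * length u + Suc (length ([] :: nat list)))"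
        using * by (intro Y_mult_SP NF_in_SP) auto
      then have "Y [] * NF ws v \<in> SP (2 * length u + 2)" by (rule SP_mono) simp
      then show ?thesis by (simp add: 3)
    qed
  qed
  then show ?case by (simp add: word_append)
qed

lemma filt_subset_SP: "filt (Suc (2 * d)) n \<subseteq> SP (2 * n)"
  unfolding filt_def
proof (rule ncs.span_minimal)
  show "{word w |w. set w \<subseteq> {..<Suc (2 * d)} \<and> length w \<le> n} \<subseteq> SP (2 * n)"
    using SP_mono[OF word_in_SP] by force
  show "ncs.subspace (SP (2 * n))" unfolding SP_def by simp
qed

section \<open>Normal forms indexed by multisets\<close>

definition canon where
  "canon = (\<lambda>(A, B). Y_prod d A * word (rep B) :: 'k ncs)"

definition Idx :: "nat \<Rightarrow> (nat multiset multiset \<times> nat multiset) set" where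
  "Idx N = {(A, B). (\<forall>\<alpha>\<in>#A. set_mset \<alpha> \<subseteq> {..<d}) \<and> set_mset B \<subseteq> {..<2 * d} \<and>
      (\<Sum>\<alpha>\<in>#A. Suc (size \<alpha>)) + size B \<le> N}"

lemma prod_list_letters:
  "(\<And>a. a \<in> set xs \<Longrightarrow> f a \<in> letters_below (Suc (2 * d))) \<Longrightarrow>
   prod_list (map f xs) \<in> letters_below (Suc (2 * d))"
  using word_in_letters_below[of "[]" "Suc (2 * d)"]
  by (induction xs) (auto simp: word_Nil intro!: letters_below_mult)

lemma prod_list_perm:
  assumes "mset xs = mset ys"
    and f: "\<And>a. a \<in> set xs \<Longrightarrow> f a \<in> letters_below (Suc (2 * d))"
    and comm: "\<And>a b. a \<in> set xs \<Longrightarrow> b \<in> set xs \<Longrightarrow> f a * f b - f b * f a \<in> I"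
  shows "prod_list (map f xs) \<approx>\<^sub>I prod_list (map f ys)"
  using assms(1) order_refl[of "set xs"]
proof (induction rule: mset_eq_swap_induct)
  case (swap a b zs)
  have "prod_list (map f zs) \<in> letters_below (Suc (2 * d))"
    using swap f by (intro prod_list_letters) auto
  then have "(f a * f b - f b * f a) * prod_list (map f zs) \<in> I"
    using comm swap by (intro ideal_right) auto
  then show ?case by (simp add: cong_def algebra_simps)
next
  case (Cons a xs ys)
  then show ?case by (auto intro!: cong_mult_left f)
qed (auto intro: cong_trans)

lemma prod_list_cong:
  assumes "\<And>a. a \<in> set xs \<Longrightarrow> f a \<approx>\<^sub>I g a"
    and "\<And>a. a \<in> set xs \<Longrightarrow> f a \<in> letters_below (Suc (2 * d))"
    and "\<And>a. a \<in> set xs \<Longrightarrow> g a \<in> letters_below (Suc (2 * d))"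
  shows "prod_list (map f xs) \<approx>\<^sub>I prod_list (map g xs)"
  using assms
proof (induction xs)
  case (Cons a xs)
  have "f a * prod_list (map f xs) \<approx>\<^sub>I f a * prod_list (map g xs)"
    using Cons by (intro cong_mult_left) auto
  also have "\<dots> \<approx>\<^sub>I g a * prod_list (map g xs)"
    using Cons by (intro cong_mult_right prod_list_letters) auto
  finally show ?case by simp
qed auto

lemma word_eq_prod_list: "word v = prod_list (map (\<lambda>i. word [i]) v)"
proof (induction v)
  case (Cons a v)
  then show ?case by (subst word_Cons) simp
qed (simp add: word_Nil)

text \<open>Three reorderings are combined: of the letters inside each Y (\<open>Y_perm\<close>), of
  the Y's among themselves (\<open>C_in_I\<close>), and of the trailing x_i and t_i.\<close>

lemma NF_cong_canon:
  assumes "valid ws v"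
  shows "NF ws v \<approx>\<^sub>I canon (mset (map mset ws), mset v)"
proof -
  have ws: "set w \<subseteq> {..<d}" if "w \<in> set ws" for w
    using assms that by (auto simp: valid_def)
  let ?f = "\<lambda>\<alpha>. Y (rep \<alpha>)"
  have "prod_list (map Y ws) \<approx>\<^sub>I prod_list (map (\<lambda>w. ?f (mset w)) ws)"
    by (intro prod_list_cong Y_perm Y_letters) (auto simp: ws)
  also have "prod_list (map (\<lambda>w. ?f (mset w)) ws) = prod_list (map ?f (map mset ws))"
    by (simp add: comp_def)
  also have "\<dots> \<approx>\<^sub>I prod_list (map ?f (rep (mset (map mset ws))))"
    using C_in_I by (intro prod_list_perm) (auto simp: ws C_def)
  finally have 1: "prod_list (map Y ws) \<approx>\<^sub>I \<dots>" .
  have v: "set v \<subseteq> {..<2 * d}" using assms by (simp add: valid_def)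
  have "prod_list (map (\<lambda>i. word [i]) v) \<approx>\<^sub>I prod_list (map (\<lambda>i. word [i]) (rep (mset v)))"
    using v by (intro prod_list_perm rel_comm) (auto intro!: letter simp: less_Suc_eq)
  then have "word v \<approx>\<^sub>I word (rep (mset v))"
    by (simp only: flip: word_eq_prod_list)
  then have "prod_list (map Y ws) * word v \<approx>\<^sub>I prod_list (map Y ws) * word (rep (mset v))"
    using ws by (intro cong_mult_left prod_list_letters) auto
  also have "\<dots> \<approx>\<^sub>I prod_list (map ?f (rep (mset (map mset ws)))) * word (rep (mset v))"
    using v 1 by (intro cong_mult_right word_in_letters_below) auto
  finally show ?thesis by (simp add: NF_def canon_def Y_prod_def)
qed

lemma SP_subset: "SP N \<subseteq> ncs.span (canon ` Idx N \<union> I)"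
  unfolding SP_def
proof (rule ncs.span_minimal)
  show "{NF ws v |ws v. valid ws v \<and> wt ws v \<le> N} \<union> I \<subseteq> ncs.span (canon ` Idx N \<union> I)"
  proof safe
    fix ws v assume *: "valid ws v" "wt ws v \<le> N"
    let ?p = "(mset (map mset ws), mset v)"
    have "?p \<in> Idx N"
      using * by (auto simp: Idx_def valid_def wt_def comp_def simp flip: sum_mset_sum_list mset_map)
    then have "canon ?p \<in> ncs.span (canon ` Idx N \<union> I)"
      by (intro ncs.span_base) auto
    moreover have "NF ws v - canon ?p \<in> ncs.span (canon ` Idx N \<union> I)"
      using NF_cong_canon[OF *(1)] by (intro ncs.span_base) (auto simp: cong_def)
    ultimately show "NF ws v \<in> ncs.span (canon ` Idx N \<union> I)"
      using ncs.span_add[of "NF ws v - canon ?p" _ "canon ?p"] by simp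
  next
    fix x assume "x \<in> I"
    then show "x \<in> ncs.span (canon ` Idx N \<union> I)" by (intro ncs.span_base) auto
  qed
qed simp

lemma card_indep_le:
  assumes "finite (Idx (2 * n))" "finite A" "A \<subseteq> filt (Suc (2 * d)) n" "indep_ncs I A"
  shows "card A \<le> card (Idx (2 * n))"
proof -
  have "card A \<le> card (canon ` Idx (2 * n))"
  proof (rule card_indep_ncs_le[OF subspace _ assms(2,4)])
    show "A \<subseteq> ncs.span (canon ` Idx (2 * n) \<union> I)"
      using assms(3) filt_subset_SP[of n] SP_subset[of "2 * n"] by (meson order_trans)
  qed (use assms(1) in simp)
  also have "\<dots> \<le> card (Idx (2 * n))" by (rule card_image_le) fact
  finally show ?thesis .
qed

end

section \<open>The representation and independence\<close>

text \<open>A word acts on functionals \<open>F\<close> by the transpose of its left action on lists of exponent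
  vectors, which stand for products of the variables \<open>Y\<^sub>\<alpha>\<close>: \<open>raise1 i F l\<close> sums \<open>F\<close> over the
  lists obtained by raising one entry of \<open>l\<close>, and \<open>raise2 i F l\<close> over those obtained by raising
  entries at two positions. Only functionals invariant under permutations see the variables commute.\<close>

fun raise1 :: "nat \<Rightarrow> (nat multiset list \<Rightarrow> 'k::field) \<Rightarrow> nat multiset list \<Rightarrow> 'k" where
  "raise1 i F [] = 0"
| "raise1 i F (a # l) = F (add_mset i a # l) + raise1 i (\<lambda>l. F (a # l)) l"

fun raise2 :: "nat \<Rightarrow> (nat multiset list \<Rightarrow> 'k::field) \<Rightarrow> nat multiset list \<Rightarrow> 'k" where
  "raise2 i F [] = 0"
| "raise2 i F (a # l) = raise2 i (\<lambda>l. F (a # l)) l + raise1 i (\<lambda>l. F (add_mset i a # l)) l"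

lemma raise1_linear: "raise1 i (\<lambda>l. c * F l + G l) l = c * raise1 i F l + raise1 i G l"
  by (induction l arbitrary: F G) (simp_all, simp add: algebra_simps)

lemma raise2_linear: "raise2 i (\<lambda>l. c * F l + G l) l = c * raise2 i F l + raise2 i G l"
  by (induction l arbitrary: F G) (simp_all add: raise1_linear, simp add: algebra_simps)

lemma raise1_add: "raise1 i (\<lambda>l. F l + G l) l = raise1 i F l + raise1 i G l"
  using raise1_linear[of i 1 F G l] by simp

lemma raise2_add: "raise2 i (\<lambda>l. F l + G l) l = raise2 i F l + raise2 i G l"
  using raise2_linear[of i 1 F G l] by simp

lemma raise1_raise1: "raise1 i (raise1 j F) l = raise1 j (raise1 i F) l"
  by (induction l arbitrary: F) (auto simp: algebra_simps raise1_add add_mset_commute)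

lemma raise1_raise2: "raise1 i (raise2 j F) l = raise2 j (raise1 i F) l"
  by (induction l arbitrary: F)
     (auto simp: algebra_simps raise1_add raise2_add add_mset_commute raise1_raise1)

lemma raise2_raise2: "raise2 i (raise2 j F) l = raise2 j (raise2 i F) l"
  by (induction l arbitrary: F)
     (auto simp: algebra_simps raise1_add raise2_add add_mset_commute raise1_raise1 raise1_raise2)

definition sym_fun :: "('b list \<Rightarrow> 'k) \<Rightarrow> bool" where
  "sym_fun F \<longleftrightarrow> (\<forall>p a b r. F (p @ a # b # r) = F (p @ b # a # r))"

lemma sym_fun_Cons: "sym_fun F \<Longrightarrow> sym_fun (\<lambda>l. F (a # l))"
  unfolding sym_fun_def by (metis append_Cons)

lemma sym_fun_swap: "sym_fun F \<Longrightarrow> F (a # b # r) = F (b # a # r)"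
  unfolding sym_fun_def by (metis append_Nil)

lemma sym_fun_raise1:
  assumes "sym_fun F" shows "sym_fun (raise1 i F)"
  unfolding sym_fun_def
proof (intro allI)
  fix p a b r
  show "raise1 i F (p @ a # b # r) = raise1 i F (p @ b # a # r)"
    using assms
  proof (induction p arbitrary: F)
    case Nil
    have "(\<lambda>l. F (a # b # l)) = (\<lambda>l. F (b # a # l))" for a b
      using sym_fun_swap[OF Nil] by auto
    then show ?case using sym_fun_swap[OF Nil] by (auto simp: algebra_simps)
  next
    case (Cons c p)
    then show ?case
      using Cons.IH[OF sym_fun_Cons[OF Cons.prems]] sym_fun_Cons[OF Cons.prems, of "add_mset i c"] by (auto simp: sym_fun_def)
  qed
qed

lemma sym_fun_raise2:
  assumes "sym_fun F" shows "sym_fun (raise2 i F)"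
  unfolding sym_fun_def
proof (intro allI)
  fix p a b r
  show "raise2 i F (p @ a # b # r) = raise2 i F (p @ b # a # r)"
    using assms
  proof (induction p arbitrary: F)
    case Nil
    have "(\<lambda>l. F (a # b # l)) = (\<lambda>l. F (b # a # l))" for a b
      using sym_fun_swap[OF Nil] by auto
    note this[of a b] this[of "add_mset i a" b] this[of a "add_mset i b"]
    then show ?case using sym_fun_swap[OF Nil] by (auto simp: algebra_simps)
  next
    case (Cons c p)
    then show ?case
      using Cons.IH[OF sym_fun_Cons[OF Cons.prems]]
        sym_fun_raise1[OF sym_fun_Cons[OF Cons.prems], of i] by (auto simp: sym_fun_def)
  qed
qed

section \<open>The action of the free algebra on functionals\<close>

definition act :: "nat \<Rightarrow> nat \<Rightarrow> (nat multiset list \<Rightarrow> 'k::field) \<Rightarrow> nat multiset list \<Rightarrow> 'k" where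
  "act d c F = (if c < d then raise1 c F else if c < 2 * d then raise2 (c - d) F else (\<lambda>l. F ({#} # l)))"

abbreviation act_word where "act_word d w F \<equiv> fold (act d) w F"

text \<open>For infinite support the sum takes the default value 0, so linearity and
  multiplicativity are stated on \<open>polys\<close> only.\<close>

definition act_ncs :: "nat \<Rightarrow> 'k::field ncs \<Rightarrow> (nat multiset list \<Rightarrow> 'k) \<Rightarrow> nat multiset list \<Rightarrow> 'k" where
  "act_ncs d a F l = (\<Sum>w | cf a w \<noteq> 0. cf a w * act_word d w F l)"

lemma act_linear: "act d x (\<lambda>l. c * F l + G l) = (\<lambda>l. c * act d x F l + act d x G l)"
  by (auto simp: act_def raise1_linear raise2_linear)

lemma act_word_linear:
  "act_word d w (\<lambda>l. c * F l + G l) = (\<lambda>l. c * act_word d w F l + act_word d w G l)"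
  by (induction w arbitrary: F G) (auto simp: act_linear)

lemma act_word_zero: "act_word d w (\<lambda>l. 0) = (\<lambda>l. 0)"
  using act_word_linear[of d w "-1" "\<lambda>l. 0" "\<lambda>l. 0"] by simp

lemma sym_fun_act_word: "sym_fun F \<Longrightarrow> sym_fun (act_word d w F)"
  by (induction w arbitrary: F)
     (auto simp: act_def sym_fun_raise1 sym_fun_raise2 sym_fun_Cons)

abbreviation polys :: "'k::field ncs set" where "polys \<equiv> ncs.span (range word)"

lemma word_in_polys [simp]: "word w \<in> polys"
  by (intro ncs.span_base) auto

lemma polys_induct [consumes 1, case_names zero step]:
  assumes "a \<in> polys" "P 0"
    and "\<And>c w a. a \<in> polys \<Longrightarrow> P a \<Longrightarrow> P (scl c (word w) + a)"
  shows "P a"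
proof -
  have "a \<in> polys \<and> P a"
    using assms(1)
    by (induction rule: ncs.span_induct_alt)
       (auto intro!: assms(2,3) ncs.span_add ncs.span_scale ncs.span_zero)
  then show ?thesis by simp
qed

lemma finite_support: "a \<in> polys \<Longrightarrow> finite {w. cf a w \<noteq> 0}"
proof (induction rule: polys_induct)
  case (step c w a)
  have "{v. cf (scl c (word w) + a) v \<noteq> 0} \<subseteq> insert w {w. cf a w \<noteq> 0}"
    by (auto simp: cf_word)
  then show ?case using step finite_subset by blast
qed simp

lemma act_ncs_superset:
  assumes "finite S" "{w. cf a w \<noteq> 0} \<subseteq> S"
  shows "act_ncs d a F l = (\<Sum>w\<in>S. cf a w * act_word d w F l)"
  unfolding act_ncs_def using assms by (intro sum.mono_neutral_left) auto

lemma act_ncs_word [simp]: "act_ncs d (word w) F = act_word d w F"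
  by (simp add: act_ncs_superset[of "{w}"] cf_word fun_eq_iff)

lemma act_ncs_linear:
  assumes "a \<in> polys" "b \<in> polys"
  shows "act_ncs d (scl c a + b) F = (\<lambda>l. c * act_ncs d a F l + act_ncs d b F l)"
proof
  fix l
  let ?S = "{w. cf a w \<noteq> 0} \<union> {w. cf b w \<noteq> 0}"
  have S: "finite ?S" using assms finite_support by auto
  show "act_ncs d (scl c a + b) F l = c * act_ncs d a F l + act_ncs d b F l"
    by (subst (1 2 3) act_ncs_superset[OF S])
       (auto simp: algebra_simps sum.distrib sum_distrib_left)
qed

lemma act_ncs_add:
  "a \<in> polys \<Longrightarrow> b \<in> polys \<Longrightarrow> act_ncs d (a + b) F = (\<lambda>l. act_ncs d a F l + act_ncs d b F l)"
  using act_ncs_linear[of a b d 1 F] by simp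

lemma act_ncs_diff:
  assumes "a \<in> polys" "b \<in> polys"
  shows "act_ncs d (a - b) F = (\<lambda>l. act_ncs d a F l - act_ncs d b F l)"
  using act_ncs_linear[OF assms(2,1), of d "-1" F] by simp

lemma act_ncs_zero [simp]: "act_ncs d 0 F = (\<lambda>l. 0)"
  by (simp add: act_ncs_def fun_eq_iff)

lemma polys_mult: "a \<in> polys \<Longrightarrow> b \<in> polys \<Longrightarrow> a * b \<in> polys"
  using span_word_mult[of a "\<lambda>_. True" b "\<lambda>_. True" "\<lambda>_. True"] by (simp add: full_SetCompr_eq)

text \<open>The factors act in reversed order because operators on functionals are
  transposes.\<close>

lemma act_ncs_mult:
  assumes "a \<in> polys" "b \<in> polys"
  shows "act_ncs d (a * b) F = act_ncs d b (act_ncs d a F)"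
proof -
  have *: "act_ncs d (a * word v) F = act_word d v (act_ncs d a F)" for v
    using assms(1)
  proof (induction rule: polys_induct)
    case zero
    show ?case by (simp add: act_word_zero)
  next
    case (step c w a)
    have "act_ncs d ((scl c (word w) + a) * word v) F = act_ncs d (scl c (word (w @ v)) + a * word v) F"
      by (simp add: distrib_right word_append)
    also have "\<dots> = (\<lambda>l. c * act_word d v (act_word d w F) l + act_word d v (act_ncs d a F) l)"
      using step by (subst act_ncs_linear) (auto intro!: polys_mult)
    also have "\<dots> = act_word d v (act_ncs d (scl c (word w) + a) F)"
      using step by (simp add: act_ncs_linear act_word_linear)
    finally show ?case .
  qed
  show ?thesis
    using assms(2)
  proof (induction rule: polys_induct)
    case (step c w b)
    then show ?case
      using assms(1) by (simp add: distrib_left act_ncs_linear polys_mult *)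
  qed simp
qed

lemma ad_word_in_polys [simp]: "ad_word d w \<in> polys"
  by (induction w) (auto intro!: ncs.span_diff polys_mult)

text \<open>In \<open>raise1 i F (a # l)\<close> the terms that raise an entry of \<open>l\<close>
  cancel against the other half of the commutator; only the raising of the head \<open>a\<close>
  survives.\<close>

lemma act_ad_word:
  assumes "set w \<subseteq> {..<d}"
  shows "act_ncs d (ad_word d w) F = (\<lambda>l. F (mset w # l))"
  using assms
proof (induction w arbitrary: F)
  case Nil
  show ?case by (simp add: act_def)
next
  case (Cons i w)
  then show ?case
    by (simp add: act_ncs_diff act_ncs_mult polys_mult act_def)
qed

text \<open>The letters \<open>i < d\<close> are the \<open>x\<^sub>i\<close>, the letters \<open>d + i\<close> are the \<open>t\<^sub>i\<close>, and \<open>2 * d\<close> is \<open>y\<close>.\<close>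

definition growth_rels :: "nat \<Rightarrow> 'k::field ncs set" where
  "growth_rels d =
    {word [i] * word [j] - word [j] * word [i] | i j. i < 2 * d \<and> j < 2 * d} \<union>
    {word [d + i] * ad_word d [] - (ad_word d [] * word [d + i] + ad_word d [i] * word [i]) | i. i < d} \<union>
    {ad_word d [] * ad_word d w - ad_word d w * ad_word d [] | w. set w \<subseteq> {..<d} \<and> length w \<le> d}"

abbreviation the_ideal :: "nat \<Rightarrow> 'k::field ncs set" where
  "the_ideal d \<equiv> rel_ideal (Suc (2 * d)) (growth_rels d)"

lemma finite_growth_rels: "finite (growth_rels d)"
  unfolding growth_rels_def
  by (intro finite_UnI finite_image_set finite_image_set2 finite_lists_length_le) auto

lemma fa_elem_letters_below: "a \<in> letters_below m \<Longrightarrow> fa_elem m (cf a)"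
  unfolding letters_below_def
proof (induction rule: ncs.span_induct_alt)
  case base
  then show ?case by (simp add: fa_elem_def)
next
  case (step c u a)
  then obtain w where w: "u = word w" "set w \<subseteq> {..<m}" by auto
  have "{v. cf (scl c u + a) v \<noteq> 0} \<subseteq> insert w {v. cf a v \<noteq> 0}"
    using w by (auto simp: cf_word)
  moreover from this have "finite {v. cf (scl c u + a) v \<noteq> 0}"
    using step(2) by (elim finite_subset) (simp add: fa_elem_def)
  ultimately show ?case using w(2) step(2) unfolding fa_elem_def by blast
qed

lemma growth_rels_letters_below: "(growth_rels d :: 'k::field ncs set) \<subseteq> letters_below (Suc (2 * d))"
proof -
  have *: "a * b - c \<in> letters_below m"
    if "a \<in> letters_below m" "b \<in> letters_below m" "c \<in> letters_below m" for a b c :: "'k ncs" and m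
    using letters_below_mult[OF that(1,2)] that(3) by (simp add: letters_below_def ncs.span_diff)
  have **: "a * b + c \<in> letters_below m"
    if "a \<in> letters_below m" "b \<in> letters_below m" "c \<in> letters_below m" for a b c :: "'k ncs" and m
    using letters_below_mult[OF that(1,2)] that(3) by (simp add: letters_below_def ncs.span_add)
  show ?thesis
    unfolding growth_rels_def
    by (auto intro!: * ** letters_below_mult word_in_letters_below ad_word_in_letters_below
        simp del: ad_word.simps)
qed

lemma rel_ideal_mult:
  assumes "a \<in> rel_ideal m R" "p \<in> letters_below m"
  shows "p * a \<in> rel_ideal m R" "a * p \<in> rel_ideal m R"
proof -
  let ?G = "{word u * r * word v |u v r. set u \<subseteq> {..<m} \<and> set v \<subseteq> {..<m} \<and> r \<in> R}"
  have words: "word w * x \<in> ncs.span ?G \<and> x * word w \<in> ncs.span ?G"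
    if w: "set w \<subseteq> {..<m}" and x: "x \<in> ncs.span ?G" for w x
    using x
  proof (induction rule: ncs.span_induct_alt)
    case base
    then show ?case by (simp add: ncs.span_zero)
  next
    case (step c g y)
    then obtain u v r where g: "g = word u * r * word v" "set u \<subseteq> {..<m}" "set v \<subseteq> {..<m}" "r \<in> R"
      by blast
    have "word w * g = word (w @ u) * r * word v" "g * word w = word u * r * word (v @ w)"
      unfolding g by (simp_all add: mult.assoc flip: word_append)
    moreover have "word (w @ u) * r * word v \<in> ?G" "word u * r * word (v @ w) \<in> ?G"
      using g w by (force intro!: exI)+
    ultimately have "word w * g \<in> ncs.span ?G" "g * word w \<in> ncs.span ?G"
      by (auto intro: ncs.span_base)
    then show ?case
      using step(2) by (auto simp: distrib_left distrib_right intro!: ncs.span_add ncs.span_scale)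
  qed
  have "p * a \<in> ncs.span ?G \<and> a * p \<in> ncs.span ?G"
    using assms(2) unfolding letters_below_def
  proof (induction rule: ncs.span_induct_alt)
    case base
    then show ?case by (simp add: ncs.span_zero)
  next
    case (step c g y)
    then show ?case
      using words assms(1) unfolding rel_ideal_def
      by (auto simp: distrib_left distrib_right intro!: ncs.span_add ncs.span_scale)
  qed
  then show "p * a \<in> rel_ideal m R" "a * p \<in> rel_ideal m R"
    by (auto simp: rel_ideal_def)
qed

lemma rel_in_ideal: "r \<in> R \<Longrightarrow> r \<in> rel_ideal m R"
  unfolding rel_ideal_def
  by (intro ncs.span_base CollectI exI[of _ "[]"] exI[of _ r]) (auto simp: word_Nil)

lemma growth_relsI:
  "i < 2 * d \<Longrightarrow> j < 2 * d \<Longrightarrow> word [i] * word [j] - word [j] * word [i] \<in> growth_rels d"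
  "i < d \<Longrightarrow> word [d + i] * ad_word d [] - (ad_word d [] * word [d + i] + ad_word d [i] * word [i]) \<in> growth_rels d"
  "set w \<subseteq> {..<d} \<Longrightarrow> length w \<le> d \<Longrightarrow>
    ad_word d [] * ad_word d w - ad_word d w * ad_word d [] \<in> growth_rels d"
  unfolding growth_rels_def by auto

lemma growth_relations: "growth_relations d (the_ideal d)"
proof
  show "ncs.subspace (the_ideal d)" by (simp add: rel_ideal_def)
qed (rule rel_ideal_mult rel_in_ideal[OF growth_relsI(1)] rel_in_ideal[OF growth_relsI(2)]
    rel_in_ideal[OF growth_relsI(3)]; assumption)+

lemma act_commute: "i < 2 * d \<Longrightarrow> j < 2 * d \<Longrightarrow> act d i (act d j F) = act d j (act d i F)"
  by (auto simp: act_def raise1_raise1 raise1_raise2 raise2_raise2)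

text \<open>The relation for t_i is the defining recursion of \<open>raise2\<close> with head
  \<open>{#}\<close>, and the relations among the x_i and t_i say that the raising operators
  commute. Symmetry of \<open>F\<close> handles the third family, where two entries at the front are
  exchanged.\<close>

lemma act_rel:
  assumes r: "r \<in> growth_rels d" and F: "sym_fun F"
  shows "act_ncs d r F = (\<lambda>l. 0)"
proof -
  consider (comm) i j where "i < 2 * d" "j < 2 * d" "r = word [i] * word [j] - word [j] * word [i]"
    | (second) i where "i < d" "r = word [d + i] * ad_word d [] -
        (ad_word d [] * word [d + i] + ad_word d [i] * word [i])"
    | (short) w where "set w \<subseteq> {..<d}" "r = ad_word d [] * ad_word d w - ad_word d w * ad_word d []"
    using r unfolding growth_rels_def by blast
  then show ?thesis
  proof cases
    case comm
    then show ?thesis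
      by (simp add: act_ncs_diff act_ncs_mult polys_mult act_commute[of i d j])
  next
    case second
    have "act_ncs d r F l = 0" for l
      unfolding second(2) using second(1)
      by (simp add: act_ncs_diff act_ncs_add act_ncs_mult polys_mult act_ad_word ncs.span_add
          act_def[of d "d + i"] act_def[of d i] del: ad_word.simps)
    then show ?thesis by auto
  next
    case short
    then show ?thesis
      using sym_fun_swap[OF F]
      by (simp add: act_ncs_diff act_ncs_mult polys_mult act_ad_word del: ad_word.simps)
  qed
qed

lemma letters_below_polys: "letters_below m \<subseteq> polys"
  unfolding letters_below_def by (intro ncs.span_mono) auto

lemma act_ideal:
  assumes "a \<in> the_ideal d" and F: "sym_fun F"
  shows "a \<in> polys \<and> act_ncs d a F = (\<lambda>l. 0)"
  using assms(1) unfolding rel_ideal_def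
proof (induction rule: ncs.span_induct_alt)
  case base
  then show ?case by (simp add: ncs.span_zero)
next
  case (step c g y)
  then obtain u v r where g: "g = word u * r * word v" "r \<in> growth_rels d" by blast
  then have r: "r \<in> polys" using growth_rels_letters_below letters_below_polys by blast
  \<comment> \<open>The left factor \<open>word u\<close> acts first and keeps the functional
    symmetric, so the relation in the middle annihilates it.\<close>
  have "act_ncs d g F = act_word d v (act_ncs d r (act_word d u F))"
    unfolding g by (simp add: act_ncs_mult polys_mult r)
  also have "\<dots> = (\<lambda>l. 0)"
    by (simp add: act_rel[OF g(2) sym_fun_act_word[OF F]] act_word_zero)
  finally have "act_ncs d g F = (\<lambda>l. 0)" .
  moreover have "g \<in> polys" unfolding g by (intro polys_mult r) auto
  ultimately show ?case
    using step(2) by (simp add: act_ncs_linear ncs.span_add ncs.span_scale)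
qed

lemma Y_prod_in_polys [simp]: "Y_prod d A \<in> polys"
proof -
  have "prod_list (map (\<lambda>\<alpha>. ad_word d (rep \<alpha>)) xs) \<in> polys" for xs
    using word_in_polys[of "[]"] by (induction xs) (auto intro: polys_mult simp: word_Nil)
  then show ?thesis by (simp add: Y_prod_def)
qed

text \<open>The empty list stands for the product 1, so evaluating there reads off the monomial to
  which the operator sends 1.\<close>

lemma act_Y_prod:
  fixes F :: "nat multiset list \<Rightarrow> 'k::field"
  assumes "\<forall>\<alpha>\<in>#A. set_mset \<alpha> \<subseteq> {..<d}"
  shows "act_ncs d (Y_prod d A) F [] = F (rep A)"
proof -
  let ?P = "\<lambda>xs. prod_list (map (\<lambda>\<alpha>. ad_word d (rep \<alpha>)) xs) :: 'k ncs"
  have "?P xs \<in> polys \<and> act_ncs d (?P xs) F l = F (xs @ l)"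
    if "\<forall>\<alpha>\<in>set xs. set_mset \<alpha> \<subseteq> {..<d}" for xs l and F :: "nat multiset list \<Rightarrow> 'k"
    using that
  proof (induction xs arbitrary: F l)
    case Nil
    have "act_ncs d (word []) F l = F l" by simp
    then show ?case using word_in_polys[of "[]"] by (simp add: word_Nil)
  next
    case (Cons a xs)
    then show ?case by (auto simp: act_ncs_mult act_ad_word intro!: polys_mult)
  qed
  from this[of "rep A" F "[]"] show ?thesis using assms by (simp add: Y_prod_def)
qed

definition multisets_le :: "nat \<Rightarrow> nat \<Rightarrow> nat multiset multiset set" where
  "multisets_le d n = {A. (\<forall>\<alpha>\<in>#A. set_mset \<alpha> \<subseteq> {..<d}) \<and> (\<Sum>\<alpha>\<in>#A. Suc (size \<alpha>)) \<le> n}"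

text \<open>The indicator of \<open>B\<close> is the functional dual to the monomial
  \<open>B\<close>. Being symmetric, it vanishes on the ideal and extracts one coefficient of a
  combination of products.\<close>

lemma Y_prod_separate:
  assumes "\<forall>\<alpha>\<in>#A. set_mset \<alpha> \<subseteq> {..<d}"
  shows "act_ncs d (Y_prod d A) (\<lambda>l. of_bool (mset l = B)) [] = of_bool (A = B)"
  by (simp add: act_Y_prod[OF assms])

lemma inj_on_Y_prod: "inj_on (Y_prod d :: _ \<Rightarrow> 'k::field ncs) (multisets_le d n)"
proof (rule inj_onI)
  fix A B assume *: "A \<in> multisets_le d n" "B \<in> multisets_le d n" "Y_prod d A = (Y_prod d B :: 'k ncs)"
  have "of_bool (A = B) = act_ncs d (Y_prod d A :: 'k ncs) (\<lambda>l. of_bool (mset l = B)) []"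
    using *(1) by (intro Y_prod_separate[symmetric]) (simp add: multisets_le_def)
  also have "\<dots> = of_bool (B = B)"
    unfolding *(3) using *(2) by (intro Y_prod_separate) (simp add: multisets_le_def)
  finally show "A = B" by simp
qed

lemma indep_Y_prod:
  assumes S: "finite S" "S \<subseteq> multisets_le d n"
  shows "indep_ncs (the_ideal d) (Y_prod d ` S :: 'k::field ncs set)"
  unfolding indep_ncs_def
proof (intro allI impI ballI)
  fix c :: "'k ncs \<Rightarrow> 'k" and a :: "'k ncs"
  assume I: "(\<Sum>a\<in>Y_prod d ` S. scl (c a) a) \<in> the_ideal d" and a: "a \<in> Y_prod d ` S"
  then obtain B where B: "B \<in> S" "a = Y_prod d B" by auto
  define F :: "nat multiset list \<Rightarrow> 'k" where "F = (\<lambda>l. of_bool (mset l = B))"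
  have F: "sym_fun F" by (simp add: sym_fun_def F_def add_mset_commute)
  have sum: "(\<Sum>A\<in>T. scl (c (Y_prod d A)) (Y_prod d A)) \<in> polys \<and>
      act_ncs d (\<Sum>A\<in>T. scl (c (Y_prod d A)) (Y_prod d A)) F [] = (\<Sum>A\<in>T. c (Y_prod d A) * of_bool (A = B))"
    if "T \<subseteq> S" for T
    using finite_subset[OF that S(1)] that
  proof (induction rule: finite_induct)
    case empty
    then show ?case by (simp add: ncs.span_zero)
  next
    case (insert A T)
    then have "act_ncs d (Y_prod d A) F [] = of_bool (A = B)"
      unfolding F_def using S(2) by (intro Y_prod_separate) (auto simp: multisets_le_def)
    then show ?case
      using insert by (cases "A = B") (simp_all add: act_ncs_linear ncs.span_add ncs.span_scale)
  qed
  have "inj_on (Y_prod d :: _ \<Rightarrow> 'k ncs) S"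
    using inj_on_Y_prod S(2) by (rule inj_on_subset)
  then have "(\<Sum>A\<in>S. scl (c (Y_prod d A)) (Y_prod d A)) \<in> the_ideal d"
    using I by (simp add: sum.reindex)
  from act_ideal[OF this F] have "(\<Sum>A\<in>S. c (Y_prod d A) * of_bool (A = B)) = 0"
    using sum[OF order_refl] by simp
  also have "(\<Sum>A\<in>S. c (Y_prod d A) * of_bool (A = B)) = (\<Sum>A\<in>S. if A = B then c (Y_prod d A) else 0)"
    by (intro sum.cong) auto
  finally show "c a = 0" using B S(1) by simp
qed

lemma ad_word_in_filt:
  "set w \<subseteq> {..<d} \<Longrightarrow> (ad_word d w :: 'k::field ncs) \<in> filt (Suc (2 * d)) (Suc (length w))"
proof (induction w)
  case Nil
  then show ?case unfolding filt_def by (auto intro!: ncs.span_base)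
next
  case (Cons i w)
  have i: "(word [i] :: 'k ncs) \<in> filt (Suc (2 * d)) 1"
    unfolding filt_def using Cons.prems by (intro ncs.span_base CollectI exI[of _ "[i]"]) auto
  have "(ad_word d w :: 'k ncs) \<in> filt (Suc (2 * d)) (Suc (length w))" using Cons by auto
  from filt_mult[OF i this] filt_mult[OF this i] show ?case
    by (simp add: filt_def ncs.span_diff)
qed

lemma Y_prod_in_filt:
  assumes "A \<in> multisets_le d n"
  shows "(Y_prod d A :: 'k::field ncs) \<in> filt (Suc (2 * d)) n"
proof -
  have mono: "(filt m k :: 'k ncs set) \<subseteq> filt m l" if "k \<le> l" for m k l
    unfolding filt_def using that by (intro ncs.span_mono) auto
  have "(prod_list (map (\<lambda>\<alpha>. ad_word d (rep \<alpha>)) xs) :: 'k ncs)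
      \<in> filt (Suc (2 * d)) (sum_list (map (\<lambda>\<alpha>. Suc (length (rep \<alpha>))) xs))"
    if "\<forall>\<alpha>\<in>set xs. set_mset \<alpha> \<subseteq> {..<d}" for xs
    using that
  proof (induction xs)
    case Nil
    have "(word [] :: 'k ncs) \<in> filt (Suc (2 * d)) 0"
      unfolding filt_def by (intro ncs.span_base) auto
    then show ?case by (simp add: word_Nil)
  next
    case (Cons \<alpha> xs)
    have "(ad_word d (rep \<alpha>) :: 'k ncs) \<in> filt (Suc (2 * d)) (Suc (length (rep \<alpha>)))"
      using Cons.prems by (intro ad_word_in_filt) auto
    from filt_mult[OF this Cons.IH] show ?case using Cons.prems by simp
  qed
  from this[of "rep A"] have "(Y_prod d A :: 'k ncs) \<in> filt (Suc (2 * d)) (sum_list (map (\<lambda>\<alpha>. Suc (length (rep \<alpha>))) (rep A)))"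
    using assms by (auto simp: Y_prod_def multisets_le_def)
  moreover have "length (rep \<alpha>) = size \<alpha>" for \<alpha> :: "nat multiset"
    by (metis mset_rep size_mset)
  then have "sum_list (map (\<lambda>\<alpha>. Suc (length (rep \<alpha>))) (rep A)) = (\<Sum>\<alpha>\<in>#A. Suc (size \<alpha>))"
    by (simp flip: sum_mset_sum_list)
  ultimately show ?thesis using assms mono by (auto simp: multisets_le_def)
qed

section \<open>Counting weighted multisets\<close>

text \<open>Partitions into parts of several kinds, used at two levels: with weight 1 the multisets
  are exponent vectors, and with weight \<open>Suc (size \<alpha>)\<close> they are multisets of
  exponent vectors.\<close>

definition wmsets :: "'b set \<Rightarrow> ('b \<Rightarrow> nat) \<Rightarrow> nat \<Rightarrow> 'b multiset set" where
  "wmsets T w N = {A. set_mset A \<subseteq> T \<and> (\<Sum>a\<in>#A. w a) \<le> N}"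

text \<open>A truncated form of Euler's product. Splitting off the multiplicity of one kind
  (\<open>\<phi>\<close>) contributes a geometric series; positive weights bound that multiplicity
  by \<open>N\<close>, so every sum is finite.\<close>

lemma wmsets_gf:
  fixes s :: real
  assumes "finite T" "\<And>a. a \<in> T \<Longrightarrow> w a > 0" "0 < s" "s < 1"
  shows "finite (wmsets T w N) \<and>
    (\<Sum>A\<in>wmsets T w N. s ^ (\<Sum>a\<in>#A. w a)) \<le> (\<Prod>a\<in>T. 1 / (1 - s ^ w a))"
  using assms(1,2)
proof (induction rule: finite_induct)
  case empty
  have "wmsets {} w N = {{#}}" by (auto simp: wmsets_def)
  then show ?case by simp
next
  case (insert a T)
  let ?q = "s ^ w a"
  have q: "0 < ?q" "?q < 1" using insert.prems[of a] assms by (auto intro: power_Suc_less_one simp: power_less_one_iff)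
  define \<phi> where "\<phi> = (\<lambda>A. (count A a, filter_mset (\<lambda>x. x \<noteq> a) A))"
  define \<psi> where "\<psi> = (\<lambda>(m, A). replicate_mset m a + A)"
  have dec: "\<psi> (\<phi> A) = A" for A
    by (rule multiset_eqI) (auto simp: \<phi>_def \<psi>_def)
  have inj: "inj_on \<phi> S" for S by (metis dec inj_onI)
  have wt: "(\<Sum>x\<in>#A. w x) = count A a * w a + (\<Sum>x\<in>#filter_mset (\<lambda>x. x \<noteq> a) A. w x)" for A
    by (subst (1) dec[of A, symmetric]) (simp add: \<phi>_def \<psi>_def)
  have sub: "\<phi> ` wmsets (insert a T) w N \<subseteq> {..N} \<times> wmsets T w N"
  proof
    fix p assume "p \<in> \<phi> ` wmsets (insert a T) w N"
    then obtain A where A: "p = \<phi> A" "A \<in> wmsets (insert a T) w N" by auto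
    have "count A a \<le> count A a * w a" using insert.prems[of a] by simp
    also have "\<dots> \<le> N" using wt[of A] A by (simp add: wmsets_def)
    finally have "count A a \<le> N" .
    then show "p \<in> {..N} \<times> wmsets T w N"
      using A wt[of A] by (auto simp: \<phi>_def wmsets_def)
  qed
  have IH: "finite (wmsets T w N)"
    "(\<Sum>A\<in>wmsets T w N. s ^ (\<Sum>a\<in>#A. w a)) \<le> (\<Prod>a\<in>T. 1 / (1 - s ^ w a))"
    using insert by auto
  have fin: "finite ({..N} \<times> wmsets T w N)" using IH by simp
  have "(\<Sum>A\<in>wmsets (insert a T) w N. s ^ (\<Sum>a\<in>#A. w a)) =
     (\<Sum>p\<in>\<phi> ` wmsets (insert a T) w N. ?q ^ fst p * s ^ (\<Sum>a\<in>#snd p. w a))"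
    unfolding sum.reindex[OF inj] o_def
    by (intro sum.cong refl) (subst wt, simp add: \<phi>_def power_add mult.commute flip: power_mult)
  also have "\<dots> \<le> (\<Sum>p\<in>{..N} \<times> wmsets T w N. ?q ^ fst p * s ^ (\<Sum>a\<in>#snd p. w a))"
    using assms q by (intro sum_mono2 fin sub) auto
  also have "\<dots> = (\<Sum>m\<le>N. ?q ^ m) * (\<Sum>A\<in>wmsets T w N. s ^ (\<Sum>a\<in>#A. w a))"
    by (simp add: sum_product sum.cartesian_product case_prod_beta)
  also have "\<dots> \<le> 1 / (1 - ?q) * (\<Prod>a\<in>T. 1 / (1 - s ^ w a))"
  proof (intro mult_mono IH)
    have "(1 - ?q) * (\<Sum>m\<le>N. ?q ^ m) \<le> 1"
      unfolding sum_gp_basic using q by simp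
    then show "(\<Sum>m\<le>N. ?q ^ m) \<le> 1 / (1 - ?q)" using q by (simp add: field_simps)
  qed (use q assms in \<open>auto intro!: sum_nonneg\<close>)
  finally show ?case
    using insert finite_subset[OF sub fin] finite_imageD[OF _ inj] by simp
qed

lemma finite_wmsets:
  assumes "finite T" "\<And>a. a \<in> T \<Longrightarrow> w a > 0"
  shows "finite (wmsets T w N)"
  using wmsets_gf[OF assms, where s = "1/2" and N = N] by simp

text \<open>Rankin's trick: with s = exp (- 1 / L) every counted multiset has s ^ weight \<ge> s ^
  N, so the count is at most s ^ (- N) times the generating function.\<close>

lemma card_wmsets_le:
  fixes L :: nat
  assumes "finite T" "\<And>a. a \<in> T \<Longrightarrow> w a > 0" "L > 0"
  shows "real (card (wmsets T w N)) \<le> exp (N / L) * (\<Prod>a\<in>T. 1 / (1 - exp (- 1 / real L) ^ w a))"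
proof -
  let ?s = "exp (- 1 / real L)"
  have s: "0 < ?s" "?s < 1" using assms(3) by auto
  have "real (card (wmsets T w N)) * ?s ^ N = (\<Sum>A\<in>wmsets T w N. ?s ^ N)"
    by simp
  also have "\<dots> \<le> (\<Sum>A\<in>wmsets T w N. ?s ^ (\<Sum>a\<in>#A. w a))"
    using s by (intro sum_mono power_decreasing) (auto simp: wmsets_def)
  also have "\<dots> \<le> (\<Prod>a\<in>T. 1 / (1 - ?s ^ w a))"
    using wmsets_gf[OF assms(1,2) s, where N = N] by simp
  finally have "exp (N / L) * (real (card (wmsets T w N)) * ?s ^ N) \<le> exp (N / L) * (\<Prod>a\<in>T. 1 / (1 - ?s ^ w a))"
    by simp
  also have "exp (N / L) * (real (card (wmsets T w N)) * ?s ^ N) = real (card (wmsets T w N))"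
    by (simp add: exp_minus field_simps flip: exp_of_nat_mult)
  finally show ?thesis .
qed

section \<open>Estimates for the generating function\<close>

lemma one_minus_exp_le:
  fixes x :: real
  assumes "x > 0"
  shows "1 / (1 - exp (- x)) \<le> 1 + 1 / x"
proof -
  have "exp (- x) \<le> 1 / (1 + x)"
    using exp_ge_add_one_self[of x] assms by (simp add: exp_minus field_simps)
  then have "1 - exp (- x) \<ge> x / (1 + x)" using assms by (simp add: field_simps)
  then have "1 / (1 - exp (- x)) \<le> 1 / (x / (1 + x))"
    using assms by (intro divide_left_mono mult_pos_pos) auto
  then show ?thesis using assms by (simp add: field_simps)
qed

text \<open>The factor \<open>exp (- x)\<close> pays for large x, since (1 + x) / x \<le> (d / x) (1
  + x / d) and (1 + x / d) ^ d \<le> exp x. In the application it comes from the \<open>Suc\<close>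
  in the weight of Y_\<alpha>.\<close>

lemma exp_div_one_minus_exp_power_le:
  fixes x :: real
  assumes "x > 0" "d > 0"
  shows "exp (- x) * (1 / (1 - exp (- x))) ^ d \<le> (d / x) ^ d"
proof -
  have "(1 / (1 - exp (- x))) ^ d \<le> ((1 + x) / x) ^ d"
    using one_minus_exp_le[OF assms(1)] assms(1) by (intro power_mono) (auto simp: field_simps)
  also have "\<dots> \<le> (d / x * (1 + x / d)) ^ d"
  proof (intro power_mono)
    have "1 + x \<le> d + x" using assms by linarith
    then show "(1 + x) / x \<le> d / x * (1 + x / d)" using assms by (simp add: field_simps)
  qed (use assms in auto)
  also have "\<dots> = (d / x) ^ d * (1 + x / d) ^ d" by (rule power_mult_distrib)
  also have "\<dots> \<le> (d / x) ^ d * exp x"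
    using assms exp_ge_one_plus_x_over_n_power_n[of d x] by (intro mult_left_mono) auto
  finally have "exp (- x) * (1 / (1 - exp (- x))) ^ d \<le> exp (- x) * ((d / x) ^ d * exp x)"
    by (intro mult_left_mono) auto
  also have "\<dots> = (d / x) ^ d" by (simp add: exp_minus)
  finally show ?thesis .
qed

lemma one_minus_eq_exp_suminf:
  fixes z :: real
  assumes "0 < z" "z < 1"
  shows "summable (\<lambda>k. z ^ Suc k / Suc k)" "1 / (1 - z) = exp (\<Sum>k. z ^ Suc k / Suc k)"
proof -
  show *: "summable (\<lambda>k. z ^ Suc k / Suc k)"
  proof (rule summable_comparison_test')
    show "summable (\<lambda>k. z ^ Suc k)" using assms by (simp add: summable_geometric summable_mult)
    fix k :: nat
    show "norm (z ^ Suc k / Suc k) \<le> z ^ Suc k"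
      using assms by (simp add: field_simps mult_le_cancel_left1)
  qed
  have "ln (1 - z) = (\<Sum>n. (-1) ^ n * (1 / real (n + 1)) * ((1 - z) - 1) ^ Suc n)"
    using assms by (intro ln_series) auto
  also have "\<dots> = (\<Sum>k. - (z ^ Suc k / Suc k))"
    by (intro suminf_cong) (simp add: power_minus[of z] power_mult_distrib flip: power_add mult.assoc)
  also have "\<dots> = - (\<Sum>k. z ^ Suc k / Suc k)" using * by (rule suminf_minus)
  finally have "exp (\<Sum>k. z ^ Suc k / Suc k) = exp (- ln (1 - z))" by simp
  also have "\<dots> = 1 / (1 - z)" using assms by (simp add: exp_minus field_simps)
  finally show "1 / (1 - z) = exp (\<Sum>k. z ^ Suc k / Suc k)" by simp
qed

text \<open>Bounds the sum of 1 / k ^ (d + 1) uniformly in d \<ge> 1: one factor 1 / k comes from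
  the logarithm series, the other d from (L / k) ^ d.\<close>

definition zeta2 :: real where "zeta2 = (\<Sum>k. 1 / real (Suc k) ^ 2)"

lemma summable_zeta2: "summable (\<lambda>k. 1 / real (Suc k) ^ 2)"
  using inverse_power_summable[of 2, where ?'a = real] by (subst summable_Suc_iff) (simp add: inverse_eq_divide)

lemma zeta2_nonneg: "zeta2 \<ge> 0"
  unfolding zeta2_def by (intro suminf_nonneg summable_zeta2) auto

text \<open>Exponent vectors of degree at most \<open>N\<close>; the cutoff keeps the product over
  them finite. With \<open>2 * d\<close> in place of \<open>d\<close> they index the monomials
  x^beta t^gamma.\<close>

abbreviation types_upto :: "nat \<Rightarrow> nat \<Rightarrow> nat multiset set" where
  "types_upto d N \<equiv> wmsets {..<d} (\<lambda>_. 1) N"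

text \<open>Expanding \<open>- ln (1 - z) = (\<Sum>k. z ^ k / k)\<close> in each factor and exchanging the sums reduces the
  estimate to the generating function of the exponent vectors at \<open>exp (- k / L)\<close>, which is at most
  a constant times \<open>(L / k) ^ d\<close>.\<close>

lemma types_product_le:
  assumes "d > 0" "L > 0"
  shows "(\<Prod>\<alpha>\<in>types_upto d N. 1 / (1 - exp (- 1 / real L) ^ Suc (size \<alpha>)))
    \<le> exp (real d ^ d * zeta2 * real L ^ d)"
proof -
  let ?s = "exp (- 1 / real L)" and ?T = "types_upto d N"
  have fin: "finite ?T" by (intro finite_wmsets) auto
  have s: "0 < ?s" "?s < 1" using assms by auto
  have z: "0 < ?s ^ Suc n" "?s ^ Suc n < 1" for n
    using zero_less_power[OF s(1)] power_Suc_less_one[OF s] by blast+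
  let ?t = "\<lambda>\<alpha> k. (?s ^ Suc (size \<alpha>)) ^ Suc k / Suc k"
  have "(\<Prod>\<alpha>\<in>?T. 1 / (1 - ?s ^ Suc (size \<alpha>))) = exp (\<Sum>\<alpha>\<in>?T. \<Sum>k. ?t \<alpha> k)"
    unfolding exp_sum[OF fin] using one_minus_eq_exp_suminf(2)[OF z] by (intro prod.cong) auto
  also have "(\<Sum>\<alpha>\<in>?T. \<Sum>k. ?t \<alpha> k) = (\<Sum>k. \<Sum>\<alpha>\<in>?T. ?t \<alpha> k)"
    using one_minus_eq_exp_suminf(1)[OF z] by (intro suminf_sum[symmetric]) auto
  also have "\<dots> \<le> (\<Sum>k. real d ^ d * real L ^ d * (1 / real (Suc k) ^ 2))"
  proof (rule suminf_le)
    show "summable (\<lambda>k. \<Sum>\<alpha>\<in>?T. ?t \<alpha> k)"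
      using one_minus_eq_exp_suminf(1)[OF z] by (intro summable_sum) auto
    show "summable (\<lambda>k. real d ^ d * real L ^ d * (1 / real (Suc k) ^ 2))"
      by (intro summable_mult summable_zeta2)
    fix k :: nat
    let ?q = "?s ^ Suc k" and ?x = "real (Suc k) / L"
    have q: "?q = exp (- ?x)"
      using exp_of_nat_mult[of "Suc k" "- 1 / real L"] by simp
    have "(\<Sum>\<alpha>\<in>?T. ?t \<alpha> k) = 1 / Suc k * ?q * (\<Sum>\<alpha>\<in>?T. ?q ^ (\<Sum>a\<in>#\<alpha>. 1))"
    proof -
      have "?t \<alpha> k = 1 / Suc k * ?q * ?q ^ (\<Sum>a\<in>#\<alpha>. 1)" for \<alpha> :: "nat multiset"
      proof -
        have "(a ^ i) ^ j = (a ^ j) ^ i" for a :: real and i j :: nat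
          by (metis power_mult mult.commute)
        from this[of ?s "Suc (size \<alpha>)" "Suc k"]
        have "(?s ^ Suc (size \<alpha>)) ^ Suc k = ?q ^ Suc (size \<alpha>)" .
        moreover have "(\<Sum>a\<in>#\<alpha>. 1) = size \<alpha>" by simp
        ultimately show ?thesis by (simp only: power_Suc[of ?q "size \<alpha>"]) simp
      qed
      then show ?thesis unfolding sum_distrib_left by (intro sum.cong refl)
    qed
    also have "\<dots> \<le> 1 / Suc k * ?q * (\<Prod>a<d. 1 / (1 - ?q ^ 1))"
      using wmsets_gf[of "{..<d}" "\<lambda>_. 1" ?q N] z s by (intro mult_left_mono) auto
    also have "\<dots> = 1 / Suc k * (?q * (1 / (1 - ?q)) ^ d)" by simp
    also have "\<dots> \<le> 1 / Suc k * (d / ?x) ^ d"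
      unfolding q using assms by (intro mult_left_mono exp_div_one_minus_exp_power_le) auto
    also have "\<dots> = real d ^ d * real L ^ d * (1 / (real (Suc k) ^ 1 * real (Suc k) ^ d))"
      by (simp add: power_mult_distrib power_divide)
    also have "\<dots> \<le> real d ^ d * real L ^ d * (1 / real (Suc k) ^ 2)"
      using assms unfolding power_add[symmetric]
      by (intro mult_left_mono divide_left_mono power_increasing) auto
    finally show "(\<Sum>\<alpha>\<in>?T. ?t \<alpha> k) \<le> real d ^ d * real L ^ d * (1 / real (Suc k) ^ 2)" .
  qed
  also have "\<dots> = real d ^ d * zeta2 * real L ^ d"
    unfolding zeta2_def by (subst suminf_mult[OF summable_zeta2]) simp
  finally show ?thesis by simp
qed

text \<open>The monomials in the x_i and t_i are estimated crudely, to fit the shape exp (N / L + c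
  L ^ d) of the main factor. \<open>L\<close> stays free until \<open>growth_gequiv\<close>.\<close>

lemma card_indices_le:
  assumes "d > 0" "L > 0"
  shows "real (card (wmsets (types_upto d N) (Suc \<circ> size) N \<times> types_upto (2 * d) N))
    \<le> exp (2 * (N / L) + (real d ^ d * zeta2 + 2 * d) * real L ^ d)"
proof -
  have "real (card (wmsets (types_upto d N) (Suc \<circ> size) N))
      \<le> exp (N / L) * (\<Prod>\<alpha>\<in>types_upto d N. 1 / (1 - exp (- 1 / real L) ^ (Suc \<circ> size) \<alpha>))"
    using assms by (intro card_wmsets_le finite_wmsets) auto
  also have "\<dots> \<le> exp (N / L) * exp (real d ^ d * zeta2 * real L ^ d)"
    using types_product_le[OF assms, of N] by (intro mult_left_mono) auto
  finally have 1: "real (card (wmsets (types_upto d N) (Suc \<circ> size) N)) \<le> \<dots>" .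
  have "real (card (types_upto (2 * d) N))
      \<le> exp (N / L) * (\<Prod>a<2 * d. 1 / (1 - exp (- 1 / real L) ^ 1))"
    using assms by (intro card_wmsets_le) auto
  also have "\<dots> = exp (N / L) * (1 / (1 - exp (- (1 / real L)))) ^ (2 * d)" by simp
  also have "\<dots> \<le> exp (N / L) * exp (real L) ^ (2 * d)"
  proof (intro mult_left_mono power_mono)
    have "1 / (1 - exp (- (1 / real L))) \<le> 1 + real L"
      using one_minus_exp_le[of "1 / real L"] assms by simp
    also have "\<dots> \<le> exp (real L)" by simp
    finally show "1 / (1 - exp (- (1 / real L))) \<le> exp (real L)" .
  qed (use assms in auto)
  also have "\<dots> = exp (N / L) * exp (2 * d * real L)" by (simp flip: exp_of_nat_mult)
  also have "\<dots> \<le> exp (N / L) * exp (2 * d * real L ^ d)"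
    using assms self_le_power[of "real L" d] by (intro mult_left_mono) auto
  finally have 2: "real (card (types_upto (2 * d) N)) \<le> \<dots>" .
  have "real (card (wmsets (types_upto d N) (Suc \<circ> size) N)) * real (card (types_upto (2 * d) N))
     \<le> (exp (N / L) * exp (real d ^ d * zeta2 * real L ^ d)) * (exp (N / L) * exp (2 * d * real L ^ d))"
    using 1 2 by (intro mult_mono) auto
  also have "\<dots> = exp (2 * (N / L) + (real d ^ d * zeta2 + 2 * d) * real L ^ d)"
    by (simp add: algebra_simps flip: exp_add)
  finally show ?thesis by (simp add: card_cartesian_product)
qed

section \<open>Subsets of a box of exponent vectors\<close>

definition box :: "nat \<Rightarrow> nat \<Rightarrow> nat multiset set" where
  "box d l = (\<lambda>f. \<Sum>i<d. replicate_mset (f i) i) ` ({..<d} \<rightarrow>\<^sub>E {..<l})"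

lemma card_box: "card (box d l) = l ^ d"
proof -
  have count: "count (\<Sum>i<d. replicate_mset (f i) i) j = (if j < d then f j else 0)" for f j
    by (simp add: count_sum)
  have "inj_on (\<lambda>f. \<Sum>i<d. replicate_mset (f i) i) ({..<d} \<rightarrow>\<^sub>E {..<l})"
  proof (rule inj_onI)
    fix f g assume fg: "f \<in> {..<d} \<rightarrow>\<^sub>E {..<l}" "g \<in> {..<d} \<rightarrow>\<^sub>E {..<l}"
      "(\<Sum>i<d. replicate_mset (f i) i) = (\<Sum>i<d. replicate_mset (g i) i)"
    have "f j = g j" if "j < d" for j
      using arg_cong[OF fg(3), of "\<lambda>M. count M j"] that by (simp add: count)
    then show "f = g" using fg(1,2) by (intro PiE_ext) auto
  qed
  then show ?thesis by (simp add: box_def card_image card_PiE)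
qed

lemma finite_box: "finite (box d l)"
  unfolding box_def by (intro finite_imageI finite_PiE) auto

lemma box_weight:
  assumes "\<alpha> \<in> box d l" "d > 0"
  shows "set_mset \<alpha> \<subseteq> {..<d}" "Suc (size \<alpha>) \<le> d * l"
proof -
  obtain f where f: "f \<in> {..<d} \<rightarrow>\<^sub>E {..<l}" "\<alpha> = (\<Sum>i<d. replicate_mset (f i) i)"
    using assms by (auto simp: box_def)
  show "set_mset \<alpha> \<subseteq> {..<d}"
    unfolding f(2) by (auto simp: set_mset_sum split: if_splits)
  have fl: "Suc (f i) \<le> l" if "i < d" for i using f(1) that by (auto simp: Suc_le_eq)
  have "size \<alpha> = (\<Sum>i<d. f i)" unfolding f(2) by simp
  then have "size \<alpha> + d = (\<Sum>i<d. Suc (f i))" by (simp add: sum_Suc)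
  also have "\<dots> \<le> (\<Sum>i<d. l)" using fl by (intro sum_mono) auto
  finally show "Suc (size \<alpha>) \<le> d * l" using assms(2) by simp
qed

text \<open>At most \<open>l ^ d\<close> vectors occur, each of weight at most d (l - 1) + 1 \<le> d
  l, which explains the threshold \<open>d * l ^ (d + 1)\<close>.\<close>

lemma mset_set_box_weight:
  assumes "d > 0" "d * l ^ (d + 1) \<le> n" "D \<subseteq> box d l"
  shows "(\<Sum>\<alpha>\<in>#mset_set D. Suc (size \<alpha>)) \<le> n"
proof -
  have "(\<Sum>\<alpha>\<in>#mset_set D. Suc (size \<alpha>)) = (\<Sum>\<alpha>\<in>D. Suc (size \<alpha>))"
    by (simp add: sum_unfold_sum_mset)
  also have "\<dots> \<le> (\<Sum>\<alpha>\<in>D. d * l)"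
    using box_weight(2) assms by (intro sum_mono) auto
  also have "\<dots> = card D * (d * l)" by simp
  also have "\<dots> \<le> l ^ d * (d * l)"
    using card_mono[OF finite_box assms(3)] by (simp add: card_box)
  finally show ?thesis using assms(2) by (simp add: mult_ac)
qed

section \<open>The growth preorder and intermediate growth\<close>

lemma gle_trans: "gle f g \<Longrightarrow> gle g h \<Longrightarrow> gle f h"
proof -
  assume "gle f g" "gle g h"
  then obtain C D :: nat where C: "\<And>n. f n \<le> C * g (C * n)" and D: "\<And>n. g n \<le> D * h (D * n)"
    unfolding gle_def by blast
  have "f n \<le> real (C * D) * h (C * D * n)" for n
  proof -
    have "f n \<le> C * g (C * n)" by (rule C)
    also have "\<dots> \<le> C * (D * h (D * (C * n)))" using D by (intro mult_left_mono) auto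
    finally show ?thesis by (simp add: mult_ac)
  qed
  then show "gle f h" unfolding gle_def by blast
qed

lemma intermediate_exp_powr:
  fixes a :: real
  assumes a: "1 / 2 \<le> a" "a < 1"
  shows "intermediate (\<lambda>n. exp (real n powr a))"
proof -
  let ?E = "\<lambda>n::nat. exp (real n powr a)"
  have nk: "gle (\<lambda>n. real n ^ k) ?E" for k :: nat
  proof (cases "k = 0")
    case True
    then show ?thesis unfolding gle_def by (intro exI[of _ 1]) simp
  next
    case False
    \<comment> \<open>With x = n powr a, the bound n ^ k = sqrt n ^ (2 k) \<le> x ^ (2 k) uses a
      \<ge> 1/2, and (x / (2 k)) ^ (2 k) \<le> exp x then produces this constant.\<close>
    let ?C = "(2 * k) ^ (2 * k)"
    have "real n ^ k \<le> real ?C * exp (real (?C * n) powr a)" for n :: nat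
    proof (cases "n = 0")
      case True
      then show ?thesis using False by (simp add: power_0_left)
    next
      case n: False
      let ?x = "real n powr a"
      have C: "?C \<ge> 1" using False by simp
      have "real n powr (1 / 2) \<le> ?x" using n a by (intro powr_mono) auto
      then have "(real n powr (1 / 2)) ^ (2 * k) \<le> ?x ^ (2 * k)" by (intro power_mono) auto
      then have "real n ^ k \<le> ?x ^ (2 * k)" using n by (simp add: powr_half_sqrt power_mult)
      also have "\<dots> = real ?C * (?x / real (2 * k)) ^ (2 * k)"
        using False by (simp add: power_divide)
      also have "\<dots> \<le> real ?C * (1 + ?x / real (2 * k)) ^ (2 * k)"
        using False by (intro mult_left_mono power_mono) auto
      also have "\<dots> \<le> real ?C * exp ?x"
      proof (intro mult_left_mono exp_ge_one_plus_x_over_n_power_n)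
        show "- real (2 * k) \<le> ?x" by (rule order_trans[of _ 0]) auto
      qed (use False in auto)
      also have "\<dots> \<le> real ?C * exp (real (?C * n) powr a)"
      proof (intro mult_left_mono, subst exp_le_cancel_iff, intro powr_mono2)
        show "real n \<le> real (?C * n)"
          using mult_le_mono1[OF C, of n] by (simp only: of_nat_le_iff mult_1)
      qed (use a in auto)
      finally show ?thesis .
    qed
    then show ?thesis unfolding gle_def by blast
  qed
  have not_nk: "\<not> gle ?E (\<lambda>n. real n ^ k)" for k :: nat
  proof
    assume "gle ?E (\<lambda>n. real n ^ k)"
    \<comment> \<open>The lower bound already proved for exponent \<open>Suc k\<close> would make n
      ^ Suc k at most of the order of n ^ k.\<close>
    with nk[of "Suc k"] have "gle (\<lambda>n. real n ^ Suc k) (\<lambda>n. real n ^ k)" by (rule gle_trans)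
    then obtain C :: nat where C: "\<And>n. real n ^ Suc k \<le> real C * real (C * n) ^ k"
      unfolding gle_def by blast
    let ?n = "Suc (C * C ^ k)"
    have "real ?n * real ?n ^ k \<le> real (C * C ^ k) * real ?n ^ k"
      using C[of ?n] by (simp only: power_Suc of_nat_mult power_mult_distrib of_nat_power mult_ac)
    then have "real ?n \<le> real (C * C ^ k)"
      by (rule mult_right_le_imp_le) (intro zero_less_power, simp add: add_pos_nonneg)
    then show False by simp
  qed
  have le: "gle ?E (\<lambda>n. 2 ^ n)"
  proof -
    have "?E n \<le> real 2 * 2 ^ (2 * n)" for n
    proof -
      have "real n powr a \<le> real n powr 1"
        using a powr_mono[of a 1 "real n"] by (cases "n = 0") auto
      then have "?E n \<le> exp (real n)" by simp
      also have "\<dots> = exp 1 ^ n" by (simp flip: exp_of_nat_mult)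
      also have "\<dots> \<le> 4 ^ n" using exp_le by (intro power_mono) auto
      also have "\<dots> = 2 ^ (2 * n)" by (simp add: power_mult)
      also have "\<dots> \<le> real 2 * 2 ^ (2 * n)" by simp
      finally show ?thesis .
    qed
    then show ?thesis unfolding gle_def by blast
  qed
  have not_ge: "\<not> gle (\<lambda>n. 2 ^ n) ?E"
  proof
    assume "gle (\<lambda>n. 2 ^ n) ?E"
    then obtain C :: nat where C: "\<And>n. 2 ^ n \<le> real C * exp (real (C * n) powr a)"
      unfolding gle_def by blast
    have C0: "C > 0" using C[of 0] by (cases "C = 0") auto
    \<comment> \<open>Rescaling n by \<open>C\<close> only multiplies n powr a by \<open>K\<close>,
      and a < 1 still makes the exponent sublinear.\<close>
    define K where "K = real C powr a"
    have K: "K > 0" using C0 by (simp add: K_def)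
    have "eventually (\<lambda>n::nat. real C * exp (K * real n powr a) < 2 ^ n) sequentially"
    proof -
      have "eventually (\<lambda>n::nat. ln (real C) + K * real n powr a < real n * ln 2) sequentially"
        using a K by real_asymp
      then show ?thesis
      proof eventually_elim
        case (elim n)
        then have "exp (ln (real C) + K * real n powr a) < exp (real n * ln 2)" by simp
        then show ?case using C0 by (simp add: exp_add exp_of_nat_mult)
      qed
    qed
    then obtain n :: nat where n: "real C * exp (K * real n powr a) < 2 ^ n"
      by (auto simp: eventually_sequentially)
    have "K * real n powr a = real (C * n) powr a" by (simp add: K_def powr_mult)
    then show False using C[of n] n by simp
  qed
  show ?thesis unfolding intermediate_def using nk not_nk le not_ge by blast
qed

lemma intermediate_gequiv:
  assumes "gequiv f g" "intermediate g"
  shows "intermediate f"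
  using assms unfolding intermediate_def gequiv_def by (meson gle_trans)

section \<open>Growth\<close>

lemma sum_mset_ge_member: "a \<in># A \<Longrightarrow> f a \<le> (\<Sum>x\<in>#A. f x :: nat)"
  by (auto dest: multi_member_split)

lemma multisets_le_subset: "multisets_le d N \<subseteq> wmsets (types_upto d N) (Suc \<circ> size) N"
proof
  fix A assume A: "A \<in> multisets_le d N"
  have "\<alpha> \<in> types_upto d N" if "\<alpha> \<in># A" for \<alpha>
    using A sum_mset_ge_member[OF that, of "\<lambda>\<alpha>. Suc (size \<alpha>)"] that
    by (auto simp: multisets_le_def wmsets_def)
  then show "A \<in> wmsets (types_upto d N) (Suc \<circ> size) N"
    using A by (auto simp: multisets_le_def wmsets_def comp_def)
qed

lemma finite_types: "finite (types_upto d N)" "finite (wmsets (types_upto d N) (Suc \<circ> size) N)"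
  by (auto intro!: finite_wmsets)

context
  fixes d :: nat and rels :: "(nat list \<Rightarrow> 'k::field) list"
  assumes rels: "set rels = cf ` growth_rels d"
begin

interpretation growth_relations d "the_ideal d :: 'k ncs set"
  by (rule growth_relations)

abbreviation "indices N \<equiv> wmsets (types_upto d N) (Suc \<circ> size) N \<times> types_upto (2 * d) N"

lemma Idx_subset: "Idx N \<subseteq> indices N"
proof
  fix p assume "p \<in> Idx N"
  then obtain A B where p: "p = (A, B)" "A \<in> multisets_le d N" "B \<in> types_upto (2 * d) N"
    by (auto simp: Idx_def multisets_le_def wmsets_def)
  then show "p \<in> indices N" using multisets_le_subset[of d N] by auto
qed

lemma card_indep_le_indices:
  assumes "finite A" "A \<subseteq> filt (Suc (2 * d)) n" "indep_ncs (the_ideal d :: 'k ncs set) A"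
  shows "card A \<le> card (indices (2 * n))"
proof -
  have fin: "finite (indices (2 * n))" using finite_types by blast
  have "card A \<le> card (Idx (2 * n))"
    using finite_subset[OF Idx_subset fin] assms by (intro card_indep_le) auto
  also have "\<dots> \<le> card (indices (2 * n))" by (rule card_mono[OF fin Idx_subset])
  finally show ?thesis .
qed

text \<open>Makes the \<open>Max\<close> in the definition of the growth function meaningful: both
  \<open>Max_le_iff\<close> and \<open>Max_ge\<close> require finiteness.\<close>

lemma finite_cards:
  "finite {card A | A. finite A \<and> A \<subseteq> filt (Suc (2 * d)) n \<and> indep_ncs (the_ideal d :: 'k ncs set) A}"
  by (rule finite_subset[of _ "{..card (indices (2 * n))}"]) (auto dest: card_indep_le_indices)

lemma growth_le: "growth (Suc (2 * d)) rels n \<le> card (indices (2 * n))"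
proof -
  have "card {} \<in> {card A | A. finite A \<and> A \<subseteq> filt (Suc (2 * d)) n \<and> indep_ncs (the_ideal d :: 'k ncs set) A}"
    by (rule CollectI, rule exI[of _ "{}"]) (simp add: indep_ncs_def)
  then show ?thesis
    unfolding growth_ncs[OF rels]
    by (subst Max_le_iff[OF finite_cards]) (blast, blast dest: card_indep_le_indices)
qed

lemma growth_ge: "card (multisets_le d n) \<le> growth (Suc (2 * d)) rels n"
proof -
  have fin: "finite (multisets_le d n)"
    using finite_subset[OF multisets_le_subset] finite_types by blast
  let ?A = "Y_prod d ` multisets_le d n :: 'k ncs set"
  have "card ?A \<in> {card A | A. finite A \<and> A \<subseteq> filt (Suc (2 * d)) n \<and> indep_ncs (the_ideal d :: 'k ncs set) A}"
    using fin indep_Y_prod[OF fin order_refl] Y_prod_in_filt by blast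
  moreover have "card ?A = card (multisets_le d n)" by (rule card_image[OF inj_on_Y_prod])
  ultimately show ?thesis
    unfolding growth_ncs[OF rels] using Max_ge[OF finite_cards] by simp
qed

text \<open>Distinct subsets of the box, read as multisets without repetition, give distinct
  products of Y's.\<close>

lemma growth_ge_power:
  assumes "d > 0" "d * l ^ (d + 1) \<le> n"
  shows "2 ^ (l ^ d) \<le> growth (Suc (2 * d)) rels n"
proof -
  have sub: "mset_set ` Pow (box d l) \<subseteq> multisets_le d n"
  proof
    fix A assume "A \<in> mset_set ` Pow (box d l)"
    then obtain D where D: "A = mset_set D" "D \<subseteq> box d l" by auto
    then have "finite D" using finite_box finite_subset by blast
    then show "A \<in> multisets_le d n"
      using D mset_set_box_weight[OF assms D(2)] box_weight(1)[OF _ assms(1)]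
      by (auto simp: multisets_le_def)
  qed
  have "inj_on mset_set (Pow (box d l))"
    by (rule inj_onI) (metis PowD finite_box finite_set_mset_mset_set finite_subset)
  then have "2 ^ (l ^ d) = card (mset_set ` Pow (box d l))"
    by (simp add: card_image card_Pow finite_box card_box)
  also have "\<dots> \<le> card (multisets_le d n)"
    using finite_subset[OF multisets_le_subset] finite_types by (intro card_mono sub) blast
  also have "\<dots> \<le> growth (Suc (2 * d)) rels n" by (rule growth_ge)
  finally show ?thesis .
qed

lemma growth_gequiv:
  assumes d: "d > 0"
  shows "gequiv (\<lambda>n. real (growth (Suc (2 * d)) rels n))
    (\<lambda>n. exp (real n powr (real d / real (d + 1))))"
proof -
  let ?g = "growth (Suc (2 * d)) rels"
  define a where "a = real d / real (d + 1)"
  \<comment> \<open>The balancing scale: n / u and u ^ d both equal n powr (d / (d + 1)).\<close>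
  define u where "u = (\<lambda>n::nat. real n powr (1 / real (d + 1)))"
  have u_d: "u n ^ d = real n powr a" and u_Suc: "u n ^ (d + 1) = real n"
    and u_ge: "1 \<le> u n" if "n > 0" for n
  proof -
    have "u n > 0" using that by (simp add: u_def)
    then have pow: "u n ^ k = real n powr (1 / real (d + 1) * real k)" for k
      by (simp only: powr_realpow[symmetric] u_def powr_powr)
    show "u n ^ d = real n powr a" unfolding pow a_def by simp
    have "1 / real (d + 1) * real (d + 1) = 1" by simp
    then show "u n ^ (d + 1) = real n" unfolding pow by simp
    show "1 \<le> u n" using that by (simp add: u_def ge_one_powr_ge_zero)
  qed
  have a: "1 / 2 \<le> a" using d by (simp add: a_def field_simps)
  define K where "K = real d ^ d * zeta2 + 2 * d"
  have K: "K \<ge> 2" using d zeta2_nonneg unfolding K_def by (intro order_trans[OF _ add_increasing]) auto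
  have le: "gle (\<lambda>n. real (?g n)) (\<lambda>n. exp (real n powr a))"
  proof -
    \<comment> \<open>The 4 comes from 2 N / L with N = 2 n, and the 2 ^ d from L \<le> 2 u.\<close>
    let ?K = "4 + K * 2 ^ d"
    \<comment> \<open>\<open>exp K\<close> covers n = 0, where the bound with L = 1 is used. The
      square covers n > 0: a \<ge> 1/2 gives C powr a \<ge> sqrt C \<ge> \<open>?K\<close>.\<close>
    define C where "C = nat \<lceil>max (exp K) (?K\<^sup>2)\<rceil>"
    have C: "exp K \<le> C" "?K\<^sup>2 \<le> C" unfolding C_def by linarith+
    have Kpos: "?K \<ge> 1" using K by (simp add: add_increasing2)
    have C1: "1 \<le> real C" using C(2) one_le_power[OF Kpos, of 2] by linarith
    have upper: "real (?g n) \<le> exp (4 * (n / L) + K * real L ^ d)" if "L > 0" for n L :: nat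
    proof -
      have "real (?g n) \<le> real (card (indices (2 * n)))" using growth_le[of n] by simp
      also have "\<dots> \<le> exp (2 * (real (2 * n) / L) + K * real L ^ d)"
        using card_indices_le[OF d that, of "2 * n"] by (simp add: K_def)
      finally show ?thesis by simp
    qed
    have "real (?g n) \<le> C * exp (real (C * n) powr a)" for n
    proof (cases "n = 0")
      case True
      then show ?thesis using upper[of 1 0] C(1) by simp
    next
      case False
      define L where "L = nat \<lceil>u n\<rceil>"
      have L: "u n \<le> L" "real L \<le> 2 * u n" "L > 0"
        using u_ge[of n] False unfolding L_def by linarith+
      have "n / L \<le> n / u n" using L u_ge[of n] False by (intro divide_left_mono) auto
      also have "\<dots> = u n ^ d"
        using u_Suc[of n] u_ge[of n] False by (simp add: field_simps)
      finally have 1: "n / L \<le> u n ^ d" .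
      have "real L ^ d \<le> (2 * u n) ^ d" using L by (intro power_mono) auto
      then have "K * real L ^ d \<le> K * (2 * u n) ^ d" using K by (intro mult_left_mono) auto
      moreover have "?K * u n ^ d = 4 * u n ^ d + K * (2 * u n) ^ d"
        by (simp add: power_mult_distrib algebra_simps)
      ultimately have "4 * (n / L) + K * real L ^ d \<le> ?K * u n ^ d"
        using 1 by linarith
      also have "\<dots> \<le> real C powr a * real n powr a"
      proof -
        have "?K = sqrt (?K\<^sup>2)" using Kpos by simp
        also have "\<dots> \<le> sqrt C" using C(2) by (rule real_sqrt_le_mono)
        also have "\<dots> = real C powr (1 / 2)" by (simp add: powr_half_sqrt)
        also have "\<dots> \<le> real C powr a" using C1 a by (intro powr_mono) auto
        finally show ?thesis using u_d[of n] False by (intro mult_mono) auto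
      qed
      also have "\<dots> = real (C * n) powr a" by (simp add: powr_mult)
      finally have "real (?g n) \<le> exp (real (C * n) powr a)"
        using upper[OF L(3), of n] by (meson exp_le_cancel_iff order_trans)
      also have "\<dots> \<le> C * exp (real (C * n) powr a)" using C1 by simp
      finally show ?thesis .
    qed
    then show ?thesis unfolding gle_def by blast
  qed
  have ge: "gle (\<lambda>n. exp (real n powr a)) (\<lambda>n. real (?g n))"
  proof -
    \<comment> \<open>The side length satisfies l \<le> 3 u, so d l ^ (d + 1) is at most this
      constant times n.\<close>
    let ?C = "d * 3 ^ (d + 1)"
    have C: "?C \<ge> 1" using d by simp
    have "exp (real n powr a) \<le> ?C * real (?g (?C * n))" for n
    proof -
      have "exp (real n powr a) \<le> real (?g (?C * n))"
      proof (cases "n = 0")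
        case True
        then show ?thesis using growth_ge_power[OF d, of 0 0] d by (simp add: power_0_left)
      next
        case False
        \<comment> \<open>The factor 2 compensates for the base 2: l ^ d \<ge> 2 u ^ d, hence 2 ^ (l
          ^ d) \<ge> 4 powr (u ^ d) \<ge> exp (u ^ d).\<close>
        define l where "l = nat \<lceil>2 * u n\<rceil>"
        have l: "2 * u n \<le> l" "real l \<le> 3 * u n"
          using u_ge[of n] False unfolding l_def by linarith+
        have "real (d * l ^ (d + 1)) \<le> d * (3 * u n) ^ (d + 1)"
          unfolding of_nat_mult of_nat_power using l by (intro mult_left_mono power_mono) auto
        also have "\<dots> = real (?C * n)"
          using u_Suc[of n] False by (simp only: power_mult_distrib) simp
        finally have "d * l ^ (d + 1) \<le> ?C * n" by (simp only: of_nat_le_iff)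
        then have "2 ^ (l ^ d) \<le> ?g (?C * n)" by (rule growth_ge_power[OF d])
        then have g: "(2 :: real) ^ (l ^ d) \<le> real (?g (?C * n))"
          by (metis of_nat_le_iff of_nat_numeral of_nat_power)
        have "2 * u n ^ d \<le> 2 ^ d * u n ^ d"
          using self_le_power[of "2 :: real" d] d u_ge[of n] False by (intro mult_right_mono) auto
        also have "\<dots> = (2 * u n) ^ d" by (simp add: power_mult_distrib)
        also have "\<dots> \<le> real l ^ d" using l u_ge[of n] False by (intro power_mono) auto
        finally have *: "2 * u n ^ d \<le> real (l ^ d)" by simp
        have "exp (real n powr a) = exp 1 powr (u n ^ d)"
          using u_d[of n] False by (simp add: exp_powr_real)
        also have "\<dots> \<le> 4 powr (u n ^ d)"
          using exp_le u_ge[of n] False by (intro powr_mono2) auto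
        also have "\<dots> = 2 powr (2 * u n ^ d)" by (simp flip: powr_powr)
        also have "\<dots> \<le> 2 powr real (l ^ d)" using * by (intro powr_mono) auto
        also have "\<dots> = 2 ^ (l ^ d)" by (rule powr_realpow) simp
        also note g
        finally show ?thesis .
      qed
      also have "\<dots> \<le> ?C * real (?g (?C * n))"
        using mult_right_mono[of 1 "real ?C" "real (?g (?C * n))"] of_nat_mono[OF C, where ?'a = real]
        by simp
      finally show ?thesis .
    qed
    then show ?thesis unfolding gle_def by blast
  qed
  show ?thesis using le ge by (simp add: gequiv_def a_def)
qed

end

theorem theorem1:
  fixes d :: nat
  assumes "d > 0"
  shows "\<exists>(m::nat) (rels :: (nat list \<Rightarrow> 'k::field) list).
           (\<forall>r\<in>set rels. fa_elem m r) \<and>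
           gequiv (\<lambda>n. real (growth m rels n))
                  (\<lambda>n. exp (real n powr (real d / real (d + 1)))) \<and>
           intermediate (\<lambda>n. real (growth m rels n))"
proof -
  have "finite (cf ` growth_rels d :: (nat list \<Rightarrow> 'k) set)"
    by (intro finite_imageI finite_growth_rels)
  then obtain rels :: "(nat list \<Rightarrow> 'k) list" where rels: "set rels = cf ` growth_rels d"
    using finite_list by blast
  have "\<forall>r\<in>set rels. fa_elem (Suc (2 * d)) r"
    unfolding rels using growth_rels_letters_below[of d, where ?'k = 'k]
    by (auto intro!: fa_elem_letters_below)
  moreover have eq: "gequiv (\<lambda>n. real (growth (Suc (2 * d)) rels n))
      (\<lambda>n. exp (real n powr (real d / real (d + 1))))"
    using growth_gequiv[OF rels assms] .
  moreover have "intermediate (\<lambda>n. exp (real n powr (real d / real (d + 1))))"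
    using assms by (intro intermediate_exp_powr) (auto simp: field_simps)
  ultimately show ?thesis
    using intermediate_gequiv[OF eq] by blast
qed

end
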